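(* Suppose that $A(z)$ is an entire function of finite non-integral order with $\rho(A)>1$, and that all the zeros of $A(z)$ lie in the angular sector $\theta_1<\arg z<\theta_2$, where $$\theta_2-\theta_1<\frac{\pi}{p+1}\quad\text{if } p \text{ is odd},\qquad \theta_2-\theta_1<\frac{(2p-1)\pi}{2p(p+1)}\quad\text{if } p \text{ is even},$$ and $p$ is the genus of $A(z)$. Let $B(z)$ be an entire function with Fabry gap. Then every non-trivial solution $f$ of the differential equation $f''+A(z)f'+B(z)f=0$ is of infinite order, i.e. $\rho(f)=\infty$.
   Context: All solutions of the equation with entire coefficients are entire functions; a solution is non-trivial if it is not identically zero. For an entire function $f$, the order of growth is $\rho(f)=\limsup_{r\to\infty}\frac{\log^+ T(r,f)}{\log r}$, where $T(r,f)=\frac{1}{2\pi}\int_0^{2\pi}\log^+|f(re^{i\theta})|\,d\theta$ is the Nevanlinna characteristic. The genus of an entire function of finite order is the usual genus from its Hadamard factorization. An entire function $f(z)=\sum_{n=0}^{\infty}a_{\lambda_n}z^{\lambda_n}$, where $(\lambda_n)$ is a strictly increasing infinite sequence of non-negative integers and all $a_{\lambda_n}\neq 0$, has Fabry gap if $\frac{\lambda_n}{n}\to\infty$ as $n\to\infty$. *)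

theory Defs
  imports "HOL-Complex_Analysis.Complex_Analysis"
begin

definition log_plus :: "real \<Rightarrow> real" where
  "log_plus x = (if x \<le> 1 then 0 else ln x)"

definition nevanlinna_T :: "real \<Rightarrow> (complex \<Rightarrow> complex) \<Rightarrow> real" where
  "nevanlinna_T r f =
     1 / (2 * pi) * integral {0..2 * pi} (\<lambda>\<theta>. log_plus (norm (f (of_real r * cis \<theta>))))"

definition growth_order :: "(complex \<Rightarrow> complex) \<Rightarrow> ereal" where
  "growth_order f =
     Limsup at_top (\<lambda>r::real. ereal (log_plus (nevanlinna_T r f) / ln r))"

text \<open>
  The family \<open>(a n)\<close>, \<open>n \<in> I\<close>, lists the nonzero zeros of \<open>f\<close>, repeated according to
  multiplicity; the index set \<open>I\<close> lets the family be finite (or empty) as well as infinite.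
  The number \<open>q\<close> is the least natural number for which the sum of \<open>1 / norm (a n) ^ (q + 1)\<close>
  over \<open>I\<close> converges, so the product below is the canonical product over the family (the
  factors with index outside \<open>I\<close> are 1). The genus is the maximum of \<open>q\<close> and the degree of
  the polynomial in the exponent; these do not depend on the choice of the factorization.
\<close>

definition has_genus :: "(complex \<Rightarrow> complex) \<Rightarrow> nat \<Rightarrow> bool" where
  "has_genus f p \<longleftrightarrow>
     (\<exists>(m::nat) (Q::complex poly) (I::nat set) (a::nat \<Rightarrow> complex) (q::nat).
        (\<forall>n\<in>I. a n \<noteq> 0) \<and>
        (\<lambda>n. 1 / norm (a n) ^ (q + 1)) summable_on I \<and>
        (\<forall>j<q. \<not> (\<lambda>n. 1 / norm (a n) ^ (j + 1)) summable_on I) \<and>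
        (\<forall>z. f z = z ^ m * exp (poly Q z) *
               (\<Prod>n. if n \<in> I then weierstrass_factor q (z / a n) else 1)) \<and>
        p = max (degree Q) q)"

text \<open>
  The argument is multivalued here: \<open>z\<close> belongs to the sector if some value of its argument
  lies strictly between the two bounds. The origin has no argument, although
  \<^const>\<open>is_Arg\<close> holds for it trivially.
\<close>

definition angular_sector :: "real \<Rightarrow> real \<Rightarrow> complex set" where
  "angular_sector \<theta>1 \<theta>2 = {z. z \<noteq> 0 \<and> (\<exists>\<theta>. \<theta>1 < \<theta> \<and> \<theta> < \<theta>2 \<and> is_Arg z \<theta>)}"

definition fabry_gap :: "(complex \<Rightarrow> complex) \<Rightarrow> bool" where
  "fabry_gap f \<longleftrightarrow>
     (\<exists>(l::nat \<Rightarrow> nat) (a::nat \<Rightarrow> complex).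
        strict_mono l \<and> (\<forall>n. a n \<noteq> 0) \<and>
        (\<forall>z. (\<lambda>n. a n * z ^ l n) sums f z) \<and>
        filterlim (\<lambda>n. real (l n) / real n) at_top sequentially)"

end

theory Submission
  imports Defs
begin

text \<open>
  Suppose that some solution \<open>f \<noteq> 0\<close> has finite order. The equation gives
  \<open>B = - (f''/f + A f'/f)\<close>, and the proof turns this into a bound for \<open>B\<close> that a function with
  Fabry gaps cannot satisfy.

  \<^item> An entire function of finite order satisfies \<open>\<bar>f z\<bar> \<le> exp (\<bar>z\<bar>^K)\<close> for large \<open>z\<close>, since
  \<open>log \<bar>f\<bar>\<close> on a disc is controlled by the mean of \<open>log\<^sup>+ \<bar>f\<bar>\<close> over a larger circle
  (\<open>growth_order_finite_imp_norm_bound\<close>). Hence, around every far away point, some circle of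
  radius less than 1 keeps a distance at least \<open>\<bar>z\<bar>^(-k)\<close> from the zeros of \<open>f\<close>, and on it
  \<open>f'/f\<close> and \<open>f''/f\<close> are bounded by a power of \<open>\<bar>z\<bar>\<close>
  (\<open>log_derivatives_polynomially_bounded\<close>). By the maximum principle, \<open>B\<close> is then bounded at the
  centre of the circle by a power of \<open>\<bar>z\<bar>\<close> times the local maximum of \<open>\<bar>A\<bar>\<close>. In particular
  \<open>B\<close> has finite order, because \<open>A\<close> has.

  \<^item> There is a sector in which \<open>\<bar>A\<bar> \<le> 1\<close> far from the origin
  (\<open>genus_controls_growth_and_decay\<close>). Write \<open>A\<close> as \<open>z^m exp Q\<close> times a canonical product of
  genus \<open>q\<close>. If \<open>q = p\<close>, the condition on the opening guarantees that there are directions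
  in which every quotient \<open>z / a\<^sub>n\<close> has an argument \<open>\<phi>\<close> with \<open>cos ((p + 1) \<phi>) \<ge> 0\<close> and
  \<open>cos (p \<phi>) < 0\<close>. In such a direction every elementary factor is at most 1 in modulus and at
  most \<open>exp (- \<kappa> \<bar>z / a\<^sub>n\<bar>^p)\<close> once \<open>\<bar>z\<bar> \<ge> 2 \<bar>a\<^sub>n\<bar>\<close>. Since the sum of \<open>\<bar>a\<^sub>n\<bar>^(-p)\<close>
  diverges, the product decays faster than \<open>exp (- W \<bar>z\<bar>^p)\<close> for every \<open>W\<close> and overwhelms
  \<open>exp Q\<close>. If \<open>q < p\<close>, then \<open>p = deg Q\<close>, the product is \<open>exp (o(\<bar>z\<bar>^p))\<close>, and \<open>exp Q\<close> itself
  decays in a sector. The case \<open>p = 0\<close> is impossible because the order exceeds 1.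

  \<^item> So \<open>B\<close> is of finite order and polynomially bounded in a sector. On a suitable circle the
  power series of \<open>B\<close> may be cut off at a frequency comparable with the logarithm \<open>L\<close> of the
  maximum modulus, and Fabry gaps leave only \<open>o(L)\<close> terms. An inequality of Turan type bounds
  the coefficients of a trigonometric sum with \<open>m\<close> terms by \<open>C^m\<close> times its supremum on an arc,
  which gives \<open>L \<le> o(L) + O(log r)\<close>; this is impossible for an infinite power series
  (\<open>fabry_gap_not_polynomially_bounded_in_sector\<close>).
\<close>

section \<open>The characteristic controls the maximum modulus\<close>

text \<open>
  The map \<open>w \<mapsto> w / (2 A - w)\<close> sends the half plane \<open>Re w < A\<close> to the unit disc, so the Schwarz
  lemma applies to its composition with \<open>f\<close>.
\<close>

lemma Borel_Caratheodory:
  assumes holf: "f holomorphic_on ball 0 s" and f0: "f 0 = 0" and "s > 0"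
    and Re: "\<And>z. norm z < s \<Longrightarrow> Re (f z) < A" and z: "norm z < s"
  shows "norm (f z) \<le> 2 * A * norm z / (s - norm z)"
proof -
  have A: "A > 0" using Re[of 0] f0 \<open>s > 0\<close> by simp
  have less: "norm (f w) < norm (of_real (2 * A) - f w)" if "norm w < s" for w
  proof -
    have "A * Re (f w) < A * A" using Re[OF that] A by simp
    hence "(Re (f w))\<^sup>2 + (Im (f w))\<^sup>2 < (2 * A - Re (f w))\<^sup>2 + (Im (f w))\<^sup>2"
      by (simp add: power2_eq_square algebra_simps)
    hence "(norm (f w))\<^sup>2 < (norm (of_real (2 * A) - f w))\<^sup>2"
      by (simp add: cmod_power2)
    thus ?thesis by (rule power2_less_imp_less) simp
  qed
  define g where "g = (\<lambda>w. f (of_real s * w) / (of_real (2 * A) - f (of_real s * w)))"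
  have ns: "norm (of_real s * w) < s" if "norm w < 1" for w :: complex
    using that \<open>s > 0\<close> by (simp add: norm_mult)
  have nz: "of_real (2 * A) - f (of_real s * w) \<noteq> 0" if "norm w < 1" for w
    using less[OF ns[OF that]] by auto
  have "(\<lambda>w. f (of_real s * w)) holomorphic_on ball 0 1"
  proof -
    have "f \<circ> (\<lambda>w. of_real s * w) holomorphic_on ball 0 1"
      by (rule holomorphic_on_compose_gen[OF _ holf])
         (use ns in \<open>auto intro!: holomorphic_intros\<close>)
    thus ?thesis by (simp add: o_def)
  qed
  hence holg: "g holomorphic_on ball 0 1"
    unfolding g_def using nz by (intro holomorphic_intros) auto
  have g0: "g 0 = 0" by (simp add: g_def f0)
  have g1: "norm (g w) < 1" if "norm w < 1" for w
    using less[OF ns[OF that]] nz[OF that] by (simp add: g_def norm_divide)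
  define w where "w = z / of_real s"
  have w: "norm w < 1" "of_real s * w = z" using z \<open>s > 0\<close> by (auto simp: w_def norm_divide)
  have "norm (g w) \<le> norm w"
    by (rule Schwarz_Lemma(1)[OF holg g0 g1 w(1)])
  hence "norm (f z) \<le> norm w * norm (of_real (2 * A) - f z)"
    using nz[OF w(1)] unfolding g_def w(2) by (simp add: norm_divide divide_simps)
  also have "\<dots> \<le> norm w * (2 * A + norm (f z))"
    using norm_triangle_ineq4[of "of_real (2*A)" "f z"] A by (intro mult_left_mono) auto
  finally have "norm (f z) * (1 - norm w) \<le> 2 * A * norm w" by (simp add: algebra_simps)
  hence "norm (f z) \<le> 2 * A * norm w / (1 - norm w)" using w by (simp add: pos_le_divide_eq)
  also have "\<dots> = 2 * A * norm z / (s - norm z)"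
    using \<open>s > 0\<close> z by (simp add: w_def norm_divide field_simps)
  finally show ?thesis .
qed

text \<open>
  On the unit circle \<open>cnj z = 1 / z\<close>, so a product \<open>z^i * cnj z^j\<close> is either a power of \<open>z\<close> or the
  conjugate of one, and conjugation does not change real parts.
\<close>

lemma Re_poly_mult_cnj:
  "\<exists>s. \<forall>z\<in>sphere 0 1. Re (poly p z * cnj (poly q z)) = Re (poly s z)"
proof -
  define R where "R = (\<lambda>f::complex\<Rightarrow>complex. \<exists>s. \<forall>z\<in>sphere 0 1. Re (f z) = Re (poly s z))"
  have R_sum: "R (\<lambda>z. \<Sum>i\<in>I. f i z)" if "finite I" "\<And>i. i \<in> I \<Longrightarrow> R (f i)" for I :: "nat set" and f
    using that
  proof (induction rule: finite_induct)
    case empty show ?case unfolding R_def by (auto intro!: exI[of _ 0])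
  next
    case (insert i I)
    then obtain s t where "\<forall>z\<in>sphere 0 1. Re (f i z) = Re (poly s z)"
      "\<forall>z\<in>sphere 0 1. Re (\<Sum>i\<in>I. f i z) = Re (poly t z)"
      unfolding R_def by fastforce
    thus ?case using insert(1,2) unfolding R_def by (intro exI[of _ "s + t"]) auto
  qed
  have mono: "R (\<lambda>z. (a * z ^ i) * cnj (b * z ^ j))" for a b i j
  proof -
    have zz: "z ^ k * cnj z ^ k = 1" if "z \<in> sphere 0 1" for z :: complex and k
      using that by (simp flip: power_mult_distrib add: complex_norm_square[symmetric])
    show ?thesis
    proof (cases "j \<le> i")
      case True
      then obtain k where k: "i = j + k" using le_Suc_ex by blast
      have "(a * z ^ i) * cnj (b * z ^ j) = poly (monom (a * cnj b) k) z" if "z \<in> sphere 0 1" for z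
        using zz[OF that, of j] by (simp add: k poly_monom power_add algebra_simps)
      thus ?thesis unfolding R_def by (intro exI[of _ "monom (a * cnj b) k"]) auto
    next
      case False
      then obtain k where k: "j = i + k" using le_Suc_ex nat_le_linear by blast
      have "(a * z ^ i) * cnj (b * z ^ j) = cnj (poly (monom (b * cnj a) k) z)" if "z \<in> sphere 0 1" for z
        using zz[OF that, of i] by (simp add: k poly_monom power_add algebra_simps)
      thus ?thesis unfolding R_def by (intro exI[of _ "monom (b * cnj a) k"]) auto
    qed
  qed
  have "R (\<lambda>z. \<Sum>i\<le>degree p. \<Sum>j\<le>degree q. (coeff p i * z ^ i) * cnj (coeff q j * z ^ j))"
    by (intro R_sum mono) auto
  thus ?thesis
    unfolding R_def poly_altdef by (simp add: sum_product cnj_sum)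
qed

text \<open>
  Real parts of polynomials are the real trigonometric polynomials. They form an algebra because
  \<open>2 Re u Re v = Re (u v) + Re (u (cnj v))\<close>, so the Stone-Weierstrass theorem applies.
\<close>

lemma Re_poly_dense_on_circle:
  fixes \<phi> :: "complex \<Rightarrow> real"
  assumes "continuous_on (sphere 0 1) \<phi>" "e > 0"
  shows "\<exists>p. \<forall>z\<in>sphere 0 1. \<bar>\<phi> z - Re (poly p z)\<bar> < e"
proof -
  define P where "P = (\<lambda>f::complex \<Rightarrow> real. \<exists>p. \<forall>z\<in>sphere 0 1. f z = Re (poly p z))"
  have "\<exists>g. P g \<and> (\<forall>z\<in>sphere 0 1. \<bar>\<phi> z - g z\<bar> < e)"
  proof (rule Stone_Weierstrass_HOL[of "sphere 0 1" P])
    show "P (\<lambda>_. c)" for c unfolding P_def by (rule exI[of _ "[:of_real c:]"]) auto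
    show "continuous_on (sphere 0 1) f" if Pf: "P f" for f
    proof -
      obtain p where "\<forall>z\<in>sphere 0 1. f z = Re (poly p z)" using Pf unfolding P_def by blast
      moreover have "continuous_on (sphere 0 1) (\<lambda>z. Re (poly p z))"
        by (intro continuous_intros)
      ultimately show ?thesis using continuous_on_cong by (metis (mono_tags, lifting))
    qed
    show "P (\<lambda>x. f x + g x)" if "P f \<and> P g" for f g
    proof -
      from that obtain p q where "\<forall>z\<in>sphere 0 1. f z = Re (poly p z)"
        "\<forall>z\<in>sphere 0 1. g z = Re (poly q z)" unfolding P_def by auto
      thus ?thesis unfolding P_def by (intro exI[of _ "p + q"]) auto
    qed
    show "P (\<lambda>x. f x * g x)" if "P f \<and> P g" for f g
    proof -
      from that obtain p q where pq: "\<forall>z\<in>sphere 0 1. f z = Re (poly p z)"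
        "\<forall>z\<in>sphere 0 1. g z = Re (poly q z)" unfolding P_def by auto
      obtain s where s: "\<forall>z\<in>sphere 0 1. Re (poly p z * cnj (poly q z)) = Re (poly s z)"
        using Re_poly_mult_cnj by blast
      show ?thesis unfolding P_def
        by (intro exI[of _ "smult (1/2) (p * q + s)"])
           (use pq s in \<open>fastforce simp: algebra_simps add_divide_distrib[symmetric]\<close>)
    qed
    show "\<exists>f. P f \<and> f x \<noteq> f y" if "x \<in> sphere 0 1 \<and> y \<in> sphere 0 1 \<and> x \<noteq> y" for x y
    proof (cases "Re x = Re y")
      case False
      thus ?thesis unfolding P_def by (intro exI[of _ Re]) (auto intro!: exI[of _ "[:0, 1:]"])
    next
      case True
      hence "Im x \<noteq> Im y" using that complex_eq_iff by blast
      thus ?thesis unfolding P_def by (intro exI[of _ Im]) (auto intro!: exI[of _ "[:0, -\<i>:]"])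
    qed
  qed (use assms in auto)
  thus ?thesis unfolding P_def by metis
qed

text \<open>
  This is Cauchy's formula for the value at the origin.
\<close>

lemma mean_Re_poly_circle:
  "((\<lambda>\<theta>. Re (poly p (cis \<theta>))) has_integral 2 * pi * Re (poly p 0)) {0..2 * pi}"
proof -
  have "((\<lambda>u. poly p u / (u - 0)) has_contour_integral (2 * of_real pi * \<i> * poly p 0)) (circlepath 0 1)"
    by (rule Cauchy_integral_circlepath_simple) (auto intro!: holomorphic_intros)
  hence "((\<lambda>t. \<i> * poly p (cis t)) has_integral (2 * of_real pi * \<i> * poly p 0)) {0..2*pi}"
    unfolding circlepath_def
    by (subst (asm) has_contour_integral_part_circlepath_iff) (simp_all add: cis_conv_exp[symmetric] mult_ac exp_eq_polar)
  hence "((\<lambda>t. Im (\<i> * poly p (cis t))) has_integral Im (2 * of_real pi * \<i> * poly p 0)) {0..2*pi}"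
    by (rule has_integral_linear[OF _ bounded_linear_Im, unfolded o_def])
  thus ?thesis by simp
qed

lemma log_plus_alt: "log_plus x = ln (max 1 x)"
  by (simp add: log_plus_def max_def)

lemma continuous_on_log_plus [continuous_intros]:
  "continuous_on S g \<Longrightarrow> continuous_on S (\<lambda>x. log_plus (g x))"
  unfolding log_plus_alt by (intro continuous_intros) (auto simp: max_def)

lemma log_plus_nonneg [simp]: "log_plus x \<ge> 0"
  by (simp add: log_plus_def)

lemma le_exp_log_plus: "x \<le> exp (log_plus x)"
  by (auto simp: log_plus_def)

text \<open>
  A Poisson-type estimate that avoids the Poisson kernel. Let \<open>Re p\<close>, for a polynomial \<open>p\<close>,
  approximate \<open>log\<^sup>+ \<bar>f\<bar>\<close> on the circle of radius \<open>R\<close> from above. By the maximum principle for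
  \<open>f exp (- p)\<close>, it dominates \<open>log \<bar>f\<bar>\<close> inside. Since \<open>Re p > 0\<close>, Harnack's inequality
  bounds it on the disc of half the radius by 3 times its value at the centre, which is its mean
  over the circle, that is, almost the characteristic.
\<close>

lemma norm_le_exp_nevanlinna_T:
  assumes holf: "f holomorphic_on UNIV" and R: "R > 0" and z: "norm z \<le> R / 2"
  shows "norm (f z) \<le> exp (3 * nevanlinna_T R f + 1)"
proof -
  define \<phi> where "\<phi> = (\<lambda>w. log_plus (norm (f (of_real R * w))))"
  have contf: "continuous_on X (\<lambda>w. f (of_real R * w))" for X
    by (rule continuous_on_compose2[OF holomorphic_on_imp_continuous_on[OF holf]])
       (auto intro!: continuous_intros)
  have "continuous_on (sphere 0 1) \<phi>" unfolding \<phi>_def by (intro continuous_intros contf)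
  then obtain p0 where p0: "\<forall>z\<in>sphere 0 1. \<bar>\<phi> z - Re (poly p0 z)\<bar> < 1/9"
    using Re_poly_dense_on_circle[of \<phi> "1/9"] by auto
  \<comment> \<open>adding the error of the approximation turns it into an upper bound\<close>
  define p where "p = p0 + [:1/9:]"
  have p: "\<phi> w < Re (poly p w)" "Re (poly p w) < \<phi> w + 2/9" if "norm w = 1" for w
  proof -
    have "\<bar>\<phi> w - Re (poly p0 w)\<bar> < 1/9" using p0 that by simp
    thus "\<phi> w < Re (poly p w)" "Re (poly p w) < \<phi> w + 2/9"
      unfolding p_def abs_less_iff by simp_all
  qed
  have holfR: "(\<lambda>w. f (of_real R * w)) holomorphic_on X" for X
  proof -
    have "f \<circ> (\<lambda>w. of_real R * w) holomorphic_on X"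
      by (rule holomorphic_on_compose_gen[OF _ holf]) (auto intro!: holomorphic_intros)
    thus ?thesis by (simp add: o_def)
  qed
  have dom: "norm (f (of_real R * w)) \<le> exp (Re (poly p w))" if "norm w \<le> 1" for w
  proof -
    have "norm (f (of_real R * w) * exp (- poly p w)) \<le> 1"
    proof (rule maximum_modulus_frontier[where S = "cball 0 1" and f = "\<lambda>w. f (of_real R * w) * exp (- poly p w)"])
      show "(\<lambda>w. f (of_real R * w) * exp (- poly p w)) holomorphic_on interior (cball 0 1)"
        by (intro holomorphic_intros holfR)
      show "continuous_on (closure (cball 0 1)) (\<lambda>w. f (of_real R * w) * exp (- poly p w))"
        by (intro continuous_intros contf)
      show "norm (f (of_real R * w) * exp (- poly p w)) \<le> 1" if "w \<in> frontier (cball 0 1)" for w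
      proof -
        have w: "norm w = 1" using that by (auto simp: frontier_cball)
        have "norm (f (of_real R * w)) \<le> exp (\<phi> w)" unfolding \<phi>_def by (rule le_exp_log_plus)
        also have "\<dots> \<le> exp (Re (poly p w))" using p(1)[OF w] by simp
        finally show ?thesis by (simp add: norm_mult exp_minus norm_divide divide_simps)
      qed
    qed (use that in auto)
    thus ?thesis by (simp add: norm_mult exp_minus norm_divide divide_simps)
  qed
  have pos: "Re (poly p w) > 0" if "norm w < 1" for w
  proof -
    obtain e where e: "e > 0" "\<And>w. norm w = 1 \<Longrightarrow> Re (poly p w) \<ge> e"
    proof -
      have "compact (sphere (0::complex) 1)" "sphere (0::complex) 1 \<noteq> {}" by auto
      moreover have "continuous_on (sphere 0 1) (\<lambda>w. Re (poly p w))" by (intro continuous_intros)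
      ultimately obtain w0 where w0: "w0 \<in> sphere 0 1" "\<forall>w\<in>sphere 0 1. Re (poly p w0) \<le> Re (poly p w)"
        using continuous_attains_inf by blast
      have "\<phi> w0 \<ge> 0" by (simp add: \<phi>_def)
      thus ?thesis using that[of "Re (poly p w0)"] w0 p(1)[of w0] by auto
    qed
    have "norm (exp (- poly p w)) \<le> exp (-e)"
    proof (rule maximum_modulus_frontier[where S = "cball 0 1" and f = "\<lambda>w. exp (- poly p w)"])
      show "norm (exp (- poly p w)) \<le> exp (-e)" if "w \<in> frontier (cball 0 1)" for w
        using e(2)[of w] that by (auto simp: frontier_cball)
    qed (use that in \<open>auto intro!: holomorphic_intros continuous_intros\<close>)
    thus ?thesis using e(1) by simp
  qed
  define w where "w = z / of_real R"
  have w: "norm w \<le> 1/2" "of_real R * w = z" using z R by (auto simp: w_def norm_divide field_simps)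
  define m where "m = Re (poly p 0)"
  have m: "m > 0" using pos[of 0] by (simp add: m_def)
  have "norm (poly p 0 - poly p w) \<le> 2 * m * norm w / (1 - norm w)"
  proof (rule Borel_Caratheodory[where f = "\<lambda>w. poly p 0 - poly p w"])
    show "Re (poly p 0 - poly p z) < m" if "norm z < 1" for z
      using pos[OF that] by (simp add: m_def)
  qed (use w in \<open>auto intro!: holomorphic_intros\<close>)
  also have "\<dots> \<le> 2 * m" using w(1) m by (simp add: pos_divide_le_eq)
  finally have "\<bar>Re (poly p 0 - poly p w)\<bar> \<le> 2 * m"
    using abs_Re_le_cmod order_trans by blast
  hence harn: "Re (poly p w) \<le> 3 * m" by (simp add: m_def)
  have int\<phi>: "(\<lambda>\<theta>. \<phi> (cis \<theta>)) integrable_on {0..2*pi}"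
    unfolding \<phi>_def
    by (intro integrable_continuous_interval continuous_intros continuous_on_compose2[OF holomorphic_on_imp_continuous_on[OF holf]]) auto
  have "2 * pi * m = integral {0..2*pi} (\<lambda>\<theta>. Re (poly p (cis \<theta>)))"
    using mean_Re_poly_circle[of p] by (simp add: m_def integral_unique)
  also have "\<dots> \<le> integral {0..2*pi} (\<lambda>\<theta>. \<phi> (cis \<theta>) + 2/9)"
    using mean_Re_poly_circle[of p] p(2)[of "cis _"]
    by (intro integral_le integrable_add int\<phi>) (auto simp: less_imp_le)
  also have "\<dots> = integral {0..2*pi} (\<lambda>\<theta>. \<phi> (cis \<theta>)) + 2 * pi * (2/9)"
    by (subst integral_add[OF int\<phi>]) auto
  also have "integral {0..2*pi} (\<lambda>\<theta>. \<phi> (cis \<theta>)) = 2 * pi * nevanlinna_T R f"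
    by (simp add: nevanlinna_T_def \<phi>_def)
  finally have "2 * pi * m \<le> 2 * pi * (nevanlinna_T R f + 2/9)" by (simp add: algebra_simps)
  hence "m \<le> nevanlinna_T R f + 2/9" by (simp add: mult_le_cancel_left_pos)
  hence "3 * m \<le> 3 * nevanlinna_T R f + 1" by simp
  hence "exp (Re (poly p w)) \<le> exp (3 * nevanlinna_T R f + 1)" using harn by simp
  with dom[of w] w show ?thesis by (auto simp del: exp_le_cancel_iff intro: order_trans)
qed

text \<open>
  The exponent \<open>2 k + 1\<close> in the proof is generous: it absorbs the constant factors and the passage
  from \<open>r\<close> to \<open>2 r\<close>.
\<close>

lemma growth_order_finite_imp_norm_bound:
  assumes holf: "f holomorphic_on UNIV" and fin: "growth_order f \<noteq> \<infinity>"
  shows "\<exists>(K::nat) R0. R0 > 0 \<and> (\<forall>z. norm z \<ge> R0 \<longrightarrow> norm (f z) \<le> exp (norm z ^ K))"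
proof -
  obtain k :: nat where "growth_order f < ereal (real k)"
    using fin by (metis PInfty_neq_ereal(1) ereal_less_eq(1) less_PInf_Ex_of_nat not_less neq_iff)
  hence "eventually (\<lambda>r. ereal (log_plus (nevanlinna_T r f) / ln r) < ereal (real k)) at_top"
    unfolding growth_order_def by (rule Limsup_lessD)
  moreover have "eventually (\<lambda>r::real. r > 16) at_top" by (rule eventually_gt_at_top)
  ultimately have "eventually (\<lambda>r. nevanlinna_T r f \<le> r ^ k \<and> r > 16) at_top"
  proof eventually_elim
    case (elim r)
    have "ln r > 0" using elim by simp
    hence "log_plus (nevanlinna_T r f) \<le> real k * ln r"
      using elim by (simp add: pos_divide_less_eq)
    also have "\<dots> = ln (r ^ k)" using elim by (simp add: ln_realpow)
    finally have "nevanlinna_T r f \<le> exp (ln (r ^ k))"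
      using le_exp_log_plus order_trans exp_le_cancel_iff by blast
    thus ?case using elim by simp
  qed
  then obtain R1 where R1: "\<And>r. r \<ge> R1 \<Longrightarrow> nevanlinna_T r f \<le> r ^ k \<and> r > 16"
    unfolding eventually_at_top_linorder by blast
  define R0 where "R0 = max R1 16"
  have "norm (f z) \<le> exp (norm z ^ (2 * k + 1))" if "norm z \<ge> R0" for z
  proof -
    define r where "r = norm z"
    have r: "r \<ge> R1" "r \<ge> 16" using that by (auto simp: R0_def r_def)
    have "norm (f z) \<le> exp (3 * nevanlinna_T (2 * r) f + 1)"
      by (rule norm_le_exp_nevanlinna_T[OF holf]) (use r in \<open>auto simp: r_def\<close>)
    also have "nevanlinna_T (2 * r) f \<le> (2 * r) ^ k" using R1[of "2 * r"] r by auto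
    hence "3 * nevanlinna_T (2 * r) f + 1 \<le> 3 * (2 * r) ^ k + 1" by simp
    also have "\<dots> \<le> 4 * (2 * r) ^ k" using one_le_power[of "2 * r" k] r by (simp add: mult.commute)
    also have "(2 * r) ^ k \<le> (r * r) ^ k" using r by (intro power_mono mult_right_mono) auto
    also have "4 * (r * r) ^ k \<le> r * (r * r) ^ k" using r by (intro mult_right_mono) auto
    also have "\<dots> = r ^ (2 * k + 1)" by (simp add: power_add power_mult power2_eq_square)
    finally show ?thesis by (simp add: r_def)
  qed
  thus ?thesis by (intro exI[of _ "2 * k + 1"] exI[of _ R0]) (auto simp: R0_def)
qed

section \<open>Logarithmic derivatives of functions of finite order\<close>

text \<open>
  Removing a zero \<open>a\<close> with \<open>\<bar>a\<bar> \<le> s\<close> means dividing by \<open>1 - z / a\<close>, which is at least 2 in modulus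
  where \<open>\<bar>z\<bar> = 3 s\<close> and equals 1 at the origin. Each removal therefore halves the bound on that
  circle and keeps the value \<open>f 0\<close>, so the number of removals is at most \<open>log\<^sub>2 (M / \<bar>f 0\<bar>)\<close>. After
  as many removals as possible no zero is left; multiplicities need no separate treatment.
\<close>

lemma divide_out_zeros:
  fixes f :: "complex \<Rightarrow> complex"
  assumes holf: "f holomorphic_on UNIV" and f0: "f 0 \<noteq> 0" and s: "s > 0"
    and M: "\<And>z. norm z = 3 * s \<Longrightarrow> norm (f z) \<le> M"
  obtains g :: "complex \<Rightarrow> complex" and a :: "nat \<Rightarrow> complex" and n :: nat where "g holomorphic_on UNIV" "\<And>z. f z = (\<Prod>i<n. 1 - z / a i) * g z"
    "\<And>i. i < n \<Longrightarrow> a i \<noteq> 0" "\<And>z. norm z \<le> s \<Longrightarrow> g z \<noteq> 0"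
    "\<And>z. norm z \<le> 3 * s \<Longrightarrow> norm (g z) \<le> M" "g 0 = f 0" "norm (f 0) * 2 ^ n \<le> M"
proof -
  define F where "F = (\<lambda>n (a :: nat \<Rightarrow> complex) g. g holomorphic_on UNIV \<and> (\<forall>z. f z = (\<Prod>i<n. 1 - z / a i) * g z) \<and>
    (\<forall>i<n. a i \<noteq> 0 \<and> norm (a i) \<le> s) \<and> g 0 = f 0)"
  have F_D: "g holomorphic_on UNIV" "g 0 = f 0" "\<And>z. f z = (\<Prod>i<n. 1 - z / a i) * g z"
    "\<And>i. i < n \<Longrightarrow> a i \<noteq> 0" "\<And>i. i < n \<Longrightarrow> norm (a i) \<le> s" if "F n a g" for n a g
    using that unfolding F_def by blast+
  have bound: "norm (g z) * 2 ^ n \<le> M" if "F n a g" "norm z \<le> 3 * s" for n and a :: "nat \<Rightarrow> complex" and g z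
  proof -
    have holg: "g holomorphic_on UNIV" using F_D(1) that by blast
    have "norm (g z) \<le> M / 2 ^ n"
    proof (rule maximum_modulus_frontier[where S = "cball 0 (3 * s)" and f = g])
      show "norm (g w) \<le> M / 2 ^ n" if "w \<in> frontier (cball 0 (3 * s))" for w
      proof -
        have w: "norm w = 3 * s" using that s by (auto simp: frontier_cball)
        have ge2: "norm (1 - w / a i) \<ge> 2" if "i < n" for i
        proof -
          have "a i \<noteq> 0" "norm (a i) \<le> s" using F_D(4,5)[OF \<open>F n a g\<close> that] by auto
          hence "norm (w / a i) \<ge> 3" using w by (simp add: norm_divide pos_le_divide_eq)
          thus ?thesis using norm_triangle_ineq2[of "w / a i" 1] by (simp add: norm_minus_commute)
        qed
        have "2 ^ n = (\<Prod>i<n. 2 :: real)" by simp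
        also have "\<dots> \<le> (\<Prod>i<n. norm (1 - w / a i))" using ge2 by (intro prod_mono) auto
        finally have "norm (g w) * 2 ^ n \<le> norm (g w) * (\<Prod>i<n. norm (1 - w / a i))"
          by (rule mult_left_mono) simp
        also have "\<dots> = norm (f w)"
        proof -
          have "f w = (\<Prod>i<n. 1 - w / a i) * g w" by (rule F_D(3)[OF \<open>F n a g\<close>])
          thus ?thesis by (simp add: norm_mult prod_norm)
        qed
        also have "\<dots> \<le> M" using M w by simp
        finally show ?thesis by (simp add: pos_le_divide_eq)
      qed
      show "g holomorphic_on interior (cball 0 (3 * s))"
        by (rule holomorphic_on_subset[OF holg]) simp
      show "continuous_on (closure (cball 0 (3 * s))) g"
        by (rule holomorphic_on_imp_continuous_on[OF holomorphic_on_subset[OF holg]]) simp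
    qed (use that s in auto)
    thus ?thesis by (simp add: pos_le_divide_eq)
  qed
  have cnt: "norm (f 0) * 2 ^ n \<le> M" if "F n a g" for n a g
    using bound[OF that, of 0] s unfolding F_D(2)[OF that] by simp
  obtain B :: nat where B: "M / norm (f 0) < 2 ^ B"
    using real_arch_pow[of 2 "M / norm (f 0)"] by auto
  have le: "n \<le> B" if "\<exists>a g. F n a g" for n
  proof (rule ccontr)
    assume "\<not> n \<le> B"
    hence "(2::real) ^ B \<le> 2 ^ n" by (intro power_increasing) auto
    moreover have "2 ^ n \<le> M / norm (f 0)" using that cnt f0 by (auto simp: field_simps)
    ultimately show False using B by linarith
  qed
  have "F 0 (\<lambda>_. 0) f" unfolding F_def using holf by simp
  hence "\<exists>a g. F 0 a g" by blast
  define n where "n = (GREATEST n. \<exists>a g. F n a g)"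
  have n_max: "m \<le> n" if "\<exists>a g. F m a g" for m
    unfolding n_def by (rule Greatest_le_nat[where P = "\<lambda>n. \<exists>a g. F n a g", OF that le])
  have "\<exists>a g. F n a g"
    unfolding n_def
    by (rule GreatestI_ex_nat[where P = "\<lambda>n. \<exists>a g. F n a g"]) (use \<open>\<exists>a g. F 0 a g\<close> le in blast)+
  then obtain a g where F: "F n a g" by blast
  have holg: "g holomorphic_on UNIV" and g0: "g 0 = f 0" by (fact F_D(1,2)[OF F])+
  have nz: "g b \<noteq> 0" if b: "norm b \<le> s" for b
  proof
    assume gb: "g b = 0"
    have b0: "b \<noteq> 0" using gb g0 f0 by auto
    define h where "h = (\<lambda>z. if z = b then deriv g b else (g z - g b) / (z - b))"
    have holh: "h holomorphic_on UNIV" unfolding h_def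
      by (rule pole_lemma_open[OF holg]) auto
    have gh: "g z = (1 - z / b) * (- b * h z)" for z
      using b0 gb by (auto simp: h_def field_simps)
    define a' where "a' = a(n := b)"
    have prod: "(\<Prod>i<Suc n. 1 - z / a' i) = (\<Prod>i<n. 1 - z / a i) * (1 - z / b)" for z
      by (simp add: a'_def)
    have "F (Suc n) a' (\<lambda>z. - b * h z)"
      unfolding F_def
    proof (intro conjI allI impI)
      show "(\<lambda>z. - b * h z) holomorphic_on UNIV" by (intro holomorphic_intros holh)
      show "f z = (\<Prod>i<Suc n. 1 - z / a' i) * (- b * h z)" for z
      proof -
        have "f z = (\<Prod>i<n. 1 - z / a i) * g z" by (rule F_D(3)[OF F])
        thus ?thesis unfolding prod gh[of z] by (simp add: mult.assoc)
      qed
      show "- b * h 0 = f 0" using gh[of 0] g0 by simp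
      show "a' i \<noteq> 0" "norm (a' i) \<le> s" if "i < Suc n" for i
        using that F_D(4,5)[OF F] b0 b by (auto simp: a'_def less_Suc_eq)
    qed
    hence "Suc n \<le> n" by (intro n_max) blast
    thus False by simp
  qed
  show thesis
  proof (rule that[where n = n and a = a and g = g])
    show "norm (g z) \<le> M" if "norm z \<le> 3 * s" for z
    proof -
      have "norm (g z) * 1 \<le> norm (g z) * 2 ^ n" by (intro mult_left_mono) auto
      thus ?thesis using bound[OF F that] by simp
    qed
    show "f z = (\<Prod>i<n. 1 - z / a i) * g z" for z by (rule F_D(3)[OF F])
  qed (use F_D(1,2,4)[OF F] nz cnt[OF F] in auto)
qed

text \<open>
  Pigeonhole: among the \<open>n + 1\<close> candidates \<open>\<delta>, 3 \<delta>, 5 \<delta>, ...\<close> below 1, each of the \<open>n\<close> points is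
  closer than \<open>\<delta>\<close> to at most one.
\<close>

lemma radius_avoiding_points:
  fixes d :: "nat \<Rightarrow> real"
  assumes \<delta>_def: "\<delta> = 1 / (4 * (real n + 1))"
  obtains t where "0 < t" "t < 1" "\<And>i. i < n \<Longrightarrow> \<bar>t - d i\<bar> \<ge> \<delta>"
proof -
  have \<delta>: "\<delta> > 0" by (simp add: \<delta>_def)
  define t where "t = (\<lambda>k::nat. (2 * real k + 1) * \<delta>)"
  have "\<exists>k\<le>n. \<forall>i<n. \<bar>t k - d i\<bar> \<ge> \<delta>"
  proof (rule ccontr)
    assume "\<not> ?thesis"
    then obtain c where c: "\<And>k. k \<le> n \<Longrightarrow> c k < n \<and> \<bar>t k - d (c k)\<bar> < \<delta>"
      by (metis not_le)
    have "inj_on c {..n}"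
    proof (rule inj_onI, rule ccontr)
      fix k l assume kl: "k \<in> {..n}" "l \<in> {..n}" "c k = c l" "k \<noteq> l"
      have "\<bar>t k - t l\<bar> < 2 * \<delta>"
      proof -
        have "\<bar>t k - d (c k)\<bar> < \<delta>" "\<bar>t l - d (c k)\<bar> < \<delta>"
          using c[of k] c[of l] kl(1,2) kl(3)[symmetric] by simp_all
        thus ?thesis by linarith
      qed
      moreover have "\<bar>t k - t l\<bar> = 2 * \<delta> * \<bar>real k - real l\<bar>"
      proof -
        have "t k - t l = 2 * \<delta> * (real k - real l)" by (simp add: t_def algebra_simps)
        thus ?thesis using \<delta> by (simp add: abs_mult)
      qed
      moreover have "\<bar>real k - real l\<bar> \<ge> 1" using kl(4) by linarith
      ultimately show False using \<delta> by simp
    qed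
    moreover have "c ` {..n} \<subseteq> {..<n}" using c by auto
    ultimately have "card {..n} \<le> card {..<n}" by (rule card_inj_on_le) auto
    thus False by simp
  qed
  then obtain k where k: "k \<le> n" "\<And>i. i < n \<Longrightarrow> \<bar>t k - d i\<bar> \<ge> \<delta>" by auto
  have "t k \<le> (2 * real n + 1) * \<delta>" using k(1) \<delta> by (simp add: t_def)
  also have "\<dots> < 1" by (simp add: \<delta>_def)
  finally have "t k < 1" .
  moreover have "t k > 0" using \<delta> by (simp add: t_def add_pos_nonneg)
  ultimately show thesis using that[of "t k"] k(2) by blast
qed

text \<open>
  Write \<open>f\<close> as the product over its zeros times \<open>g = exp h\<close>. The number of zeros is at most
  \<open>2 \<Lambda>\<close>, and \<open>Re (h - h 0) < \<Lambda>\<close>, so Borel-Caratheodory and Cauchy's inequality bound \<open>h'\<close>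
  by \<open>\<Lambda>\<close>. Then \<open>f'/f\<close> is the sum of the terms \<open>1 / (z - a\<^sub>i)\<close> and of \<open>h'\<close>, hence \<open>O(\<Lambda> / \<delta>)\<close> at
  distance \<open>\<delta>\<close> from the zeros, where \<open>\<delta>\<close> of size \<open>1 / \<Lambda>\<close> can be achieved. The second quotient follows
  from \<open>f''/f = (f'/f)' + (f'/f)\<^sup>2\<close> and Cauchy's inequality.
\<close>

lemma log_derivatives_on_circle:
  fixes f :: "complex \<Rightarrow> complex"
  assumes holf: "f holomorphic_on UNIV" and f0: "f 0 \<noteq> 0"
    and s: "norm z0 + 2 \<le> s / 4"
    and M: "\<And>z. norm z = 3 * s \<Longrightarrow> norm (f z) \<le> M"
  defines "\<Lambda> \<equiv> ln (M / norm (f 0)) + 1"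
  obtains t where "\<Lambda> \<ge> 1" "0 < t" "t < 1" "\<And>z. norm (z - z0) = t \<Longrightarrow> f z \<noteq> 0 \<and>
    norm (deriv f z / f z) \<le> 4000 * \<Lambda> ^ 4 \<and> norm (deriv (deriv f) z / f z) \<le> 4000 * \<Lambda> ^ 4"
proof -
  have s8: "s \<ge> 8" using s norm_ge_zero[of z0] by linarith
  hence spos: "s > 0" by simp
  obtain g :: "complex \<Rightarrow> complex" and a :: "nat \<Rightarrow> complex" and n :: nat where g: "g holomorphic_on UNIV" "\<And>z. f z = (\<Prod>i<n. 1 - z / a i) * g z"
    "\<And>i. i < n \<Longrightarrow> a i \<noteq> 0" "\<And>z. norm z \<le> s \<Longrightarrow> g z \<noteq> 0"
    "\<And>z. norm z \<le> 3 * s \<Longrightarrow> norm (g z) \<le> M" "g 0 = f 0" "norm (f 0) * 2 ^ n \<le> M"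
    by (rule divide_out_zeros[OF holf f0 spos M], assumption, rule that; assumption)
  have q: "2 ^ n \<le> M / norm (f 0)" using g(7) f0 by (simp add: field_simps)
  hence "ln (2 ^ n) \<le> ln (M / norm (f 0))"
    by (intro ln_mono) (auto intro: less_le_trans[OF _ q])
  hence n1: "real n * ln 2 \<le> \<Lambda> - 1" by (simp add: \<Lambda>_def ln_realpow)
  have "real n * (1/2) \<le> real n * ln 2" using ln2_ge_two_thirds by (intro mult_left_mono) auto
  hence n2: "real n \<le> 2 * \<Lambda> - 2" using n1 by linarith
  have \<Lambda>1: "\<Lambda> \<ge> 1" using n2 by linarith
  have Mpos: "M / norm (f 0) > 0" using q by (meson less_le_trans zero_less_numeral zero_less_power)
  obtain h where h: "h holomorphic_on ball 0 s" "\<And>z. z \<in> ball 0 s \<Longrightarrow> g z = exp (h z)"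
  proof (rule contractible_imp_holomorphic_log[of g "ball 0 s"])
    show "g holomorphic_on ball 0 s" using g(1) holomorphic_on_subset by blast
    show "contractible (ball (0::complex) s)" by (intro convex_imp_contractible) auto
    show "g z \<noteq> 0" if "z \<in> ball 0 s" for z using g(4)[of z] that by auto
  qed blast
  have hbd: "norm (h z - h 0) \<le> 2 * \<Lambda>" if "norm z \<le> s / 2" for z
  proof -
    have "norm (h z - h 0) \<le> 2 * \<Lambda> * norm z / (s - norm z)"
    proof (rule Borel_Caratheodory[where f = "\<lambda>z. h z - h 0"])
      show "Re (h w - h 0) < \<Lambda>" if "norm w < s" for w
      proof -
        have "exp (Re (h w - h 0)) = norm (g w) / norm (g 0)"
          using h(2)[of w] h(2)[of 0] that s8 by (simp add: exp_diff)
        also have "\<dots> \<le> M / norm (f 0)" unfolding g(6)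
            by (intro divide_right_mono g(5)) (use that s8 in auto)
        finally have "Re (h w - h 0) \<le> ln (M / norm (f 0))"
          using Mpos by (simp add: ln_ge_iff)
        thus ?thesis by (simp add: \<Lambda>_def)
      qed
    qed (use that s8 h(1) in \<open>auto intro!: holomorphic_intros\<close>)
    also have "\<dots> \<le> 2 * \<Lambda> * 1"
      using that s8 \<Lambda>1 unfolding times_divide_eq_right[symmetric]
      by (intro mult_left_mono) (auto simp: divide_le_eq_1)
    finally show ?thesis by simp
  qed
  have dh: "norm (deriv h z) \<le> \<Lambda>" if "norm z \<le> s / 4" for z
  proof -
    have sub: "norm w \<le> s / 2" if "w \<in> cball z (s/4)" for w
    proof -
      have "norm w \<le> norm z + norm (w - z)" by norm
      also have "norm (w - z) \<le> s/4" using that by (simp add: dist_norm norm_minus_commute)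
      finally show ?thesis using \<open>norm z \<le> s/4\<close> by linarith
    qed
    have hol: "(\<lambda>w. h w - h 0) holomorphic_on cball z (s/4)"
      by (intro holomorphic_intros holomorphic_on_subset[OF h(1)])
         (use sub s8 in fastforce)
    have "norm ((deriv ^^ 1) (\<lambda>w. h w - h 0) z) \<le> fact 1 * (2 * \<Lambda>) / (s/4) ^ 1"
    proof (rule Cauchy_inequality)
      show "norm (h w - h 0) \<le> 2 * \<Lambda>" if "norm (z - w) = s/4" for w
        by (rule hbd, rule sub) (use that in \<open>auto simp: dist_norm\<close>)
      show "(\<lambda>w. h w - h 0) holomorphic_on ball z (s/4)"
        by (rule holomorphic_on_subset[OF hol]) auto
      show "continuous_on (cball z (s/4)) (\<lambda>w. h w - h 0)"
        by (rule holomorphic_on_imp_continuous_on[OF hol])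
    qed (use s8 in auto)
    also have "fact 1 * (2 * \<Lambda>) / (s/4) ^ 1 \<le> \<Lambda>" using s8 \<Lambda>1 by (simp add: field_simps)
    also have "(deriv ^^ 1) (\<lambda>w. h w - h 0) z = deriv h z"
    proof -
      have "h field_differentiable at z"
        using h(1) that s8 by (intro holomorphic_on_imp_differentiable_at[of h "ball 0 s"]) auto
      thus ?thesis by simp
    qed
    finally show ?thesis .
  qed
  define D where "D = (\<lambda>z. deriv f z / f z)"
  have D: "f z \<noteq> 0 \<and> norm (D z) \<le> 3 * \<Lambda> / \<eta>"
    if z: "norm z \<le> s / 4" and \<eta>: "0 < \<eta>" "\<eta> \<le> 1" and sep: "\<And>i. i < n \<Longrightarrow> norm (z - a i) \<ge> \<eta>" for z \<eta>
  proof -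
    have zb: "z \<in> ball 0 s" using z s8 by auto
    have ne: "1 - z / a i \<noteq> 0" if "i < n" for i using sep[OF that] g(3)[OF that] \<eta> by auto
    have gz: "g z \<noteq> 0" using zb h(2) by auto
    have fz: "f z \<noteq> 0" unfolding g(2)[of z] using ne gz by auto
    have hd: "(h has_field_derivative deriv h z) (at z)"
      using h(1) zb holomorphic_derivI[of h "ball 0 s"] by auto
    have "((\<lambda>z. exp (h z)) has_field_derivative (exp (h z) * deriv h z)) (at z)"
      by (rule derivative_eq_intros hd refl | simp)+
    hence gd: "(g has_field_derivative (g z * deriv h z)) (at z)"
      using h(2) zb has_field_derivative_transform_within_open[of "\<lambda>z. exp (h z)" _ z "ball 0 s" g] by force
    have pd: "((\<lambda>z. \<Prod>i<n. 1 - z / a i) has_field_derivative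
           (\<Prod>i<n. 1 - z / a i) * (\<Sum>i<n. (- 1 / a i) / (1 - z / a i))) (at z)"
      by (rule has_field_derivative_prod') (use ne g(3) in \<open>auto intro!: derivative_eq_intros simp: field_simps\<close>)
    have "((\<lambda>z. (\<Prod>i<n. 1 - z / a i) * g z) has_field_derivative
            (\<Prod>i<n. 1 - z / a i) * (\<Sum>i<n. (- 1 / a i) / (1 - z / a i)) * g z
            + (\<Prod>i<n. 1 - z / a i) * (g z * deriv h z)) (at z)"
      using DERIV_mult[OF pd gd] by (simp add: mult_ac add_ac)
    hence "(f has_field_derivative f z * ((\<Sum>i<n. (- 1 / a i) / (1 - z / a i)) + deriv h z)) (at z)"
      unfolding g(2)[symmetric] by (simp add: g(2)[of z] algebra_simps)
    hence "deriv f z = f z * ((\<Sum>i<n. (- 1 / a i) / (1 - z / a i)) + deriv h z)"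
      by (rule DERIV_imp_deriv)
    hence "D z = (\<Sum>i<n. (- 1 / a i) / (1 - z / a i)) + deriv h z" using fz by (simp add: D_def)
    also have "(\<Sum>i<n. (- 1 / a i) / (1 - z / a i)) = (\<Sum>i<n. 1 / (z - a i))"
      using g(3) ne by (intro sum.cong) (auto simp: divide_simps)
    also have "norm ((\<Sum>i<n. 1 / (z - a i)) + deriv h z) \<le> (\<Sum>i<n. norm (1 / (z - a i))) + \<Lambda>"
      using dh[OF z] norm_sum[of "\<lambda>i. 1 / (z - a i)" "{..<n}"]
      by (intro order_trans[OF norm_triangle_ineq] add_mono) auto
    also have "(\<Sum>i<n. norm (1 / (z - a i))) \<le> (\<Sum>i<n. 1 / \<eta>)"
    proof (intro sum_mono)
      fix i assume "i \<in> {..<n}"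
      hence "norm (z - a i) \<ge> \<eta>" using sep by auto
      thus "norm (1 / (z - a i)) \<le> 1 / \<eta>" using \<eta> by (auto simp: norm_divide intro!: frac_le)
    qed
    also have "(\<Sum>i<n. 1 / \<eta>) + \<Lambda> \<le> 2 * \<Lambda> / \<eta> + \<Lambda> / \<eta>"
    proof (rule add_mono)
      show "(\<Sum>i<n. 1 / \<eta>) \<le> 2 * \<Lambda> / \<eta>" using n2 \<eta> by (simp add: divide_right_mono)
      show "\<Lambda> \<le> \<Lambda> / \<eta>" using \<eta> \<Lambda>1 by (simp add: pos_le_divide_eq mult_left_le)
    qed
    finally show ?thesis using fz by (simp add: add_divide_distrib[symmetric])
  qed
  define \<delta> where "\<delta> = 1 / (4 * (real n + 1))"
  have \<delta>: "\<delta> > 0" "\<delta> \<le> 1" by (auto simp: \<delta>_def)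
  have \<delta>\<Lambda>: "1 / \<delta> \<le> 8 * \<Lambda>" using n2 by (simp add: \<delta>_def)
  obtain t where t: "0 < t" "t < 1" "\<And>i. i < n \<Longrightarrow> \<bar>t - norm (a i - z0)\<bar> \<ge> \<delta>"
    using radius_avoiding_points[of \<delta> n "\<lambda>i. norm (a i - z0)"] \<delta>_def by metis
  have main: "f z \<noteq> 0 \<and>
    norm (deriv f z / f z) \<le> 4000 * \<Lambda> ^ 4 \<and> norm (deriv (deriv f) z / f z) \<le> 4000 * \<Lambda> ^ 4"
    if z: "norm (z - z0) = t" for z
  proof -
    have sep: "norm (w - a i) \<ge> \<delta> / 2" if "i < n" "norm (w - z) \<le> \<delta>/2" for i w
    proof -
      have "\<delta> \<le> norm (z - a i)"
      proof -
        have "\<bar>norm (z - z0) - norm (a i - z0)\<bar> \<le> norm (z - a i)"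
          using norm_triangle_ineq3[of "z - z0" "a i - z0"] by simp
        thus ?thesis using t(3)[OF that(1)] z by linarith
      qed
      also have "norm (z - a i) \<le> norm (w - a i) + norm (w - z)" by norm
      finally show ?thesis using that by linarith
    qed
    have small: "norm w \<le> s / 4" if "norm (w - z) \<le> \<delta>/2" for w
    proof -
      have "norm w \<le> norm z0 + norm (z - z0) + norm (w - z)" by norm
      thus ?thesis using s z t \<delta> that by linarith
    qed
    have DD: "f w \<noteq> 0 \<and> norm (D w) \<le> 6 * \<Lambda> / \<delta>" if "norm (w - z) \<le> \<delta>/2" for w
      using D[of w "\<delta>/2"] small[OF that] sep[OF _ that] \<delta> by simp
    have Dz: "f z \<noteq> 0" "norm (D z) \<le> 6 * \<Lambda> / \<delta>" using DD[of z] \<delta> by auto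
    have Db: "norm (D z) \<le> 48 * \<Lambda>\<^sup>2"
    proof -
      have "6 * \<Lambda> * (1 / \<delta>) \<le> 6 * \<Lambda> * (8 * \<Lambda>)" using \<delta>\<Lambda> \<Lambda>1 by (intro mult_left_mono) auto
      thus ?thesis using Dz by (simp add: power2_eq_square)
    qed
    have holdf: "deriv f holomorphic_on UNIV" by (rule holomorphic_deriv[OF holf]) simp
    have holD: "D holomorphic_on cball z (\<delta>/2)" unfolding D_def
      by (intro holomorphic_intros holomorphic_on_subset[OF holf] holomorphic_on_subset[OF holdf])
         (use DD in \<open>auto simp: dist_norm norm_minus_commute\<close>)
    have "norm ((deriv ^^ 1) D z) \<le> fact 1 * (6 * \<Lambda> / \<delta>) / (\<delta>/2) ^ 1"
    proof (rule Cauchy_inequality)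
      show "norm (D w) \<le> 6 * \<Lambda> / \<delta>" if "norm (z - w) = \<delta>/2" for w
        using DD[of w] that by (simp add: norm_minus_commute)
      show "D holomorphic_on ball z (\<delta>/2)"
        by (rule holomorphic_on_subset[OF holD]) auto
      show "continuous_on (cball z (\<delta>/2)) D"
        by (rule holomorphic_on_imp_continuous_on[OF holD])
    qed (use \<delta> in auto)
    also have "\<dots> = 12 * \<Lambda> * (1 / \<delta>)\<^sup>2" by (simp add: power2_eq_square)
    also have "\<dots> \<le> 12 * \<Lambda> * (8 * \<Lambda>)\<^sup>2"
      using \<delta>\<Lambda> \<Lambda>1 \<delta> by (intro mult_left_mono power_mono) auto
    also have "\<dots> = 768 * \<Lambda> ^ 3" by (simp add: power2_eq_square power3_eq_cube)
    finally have dD: "norm (deriv D z) \<le> 768 * \<Lambda> ^ 3" by simp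
    have fd: "(f has_field_derivative deriv f z) (at z)"
      using holf holomorphic_derivI[of f UNIV] by auto
    have fdd: "(deriv f has_field_derivative deriv (deriv f) z) (at z)"
      using holdf holomorphic_derivI[of "deriv f" UNIV] by auto
    have "deriv D z = (deriv (deriv f) z * f z - deriv f z * deriv f z) / (f z * f z)"
      unfolding D_def by (rule DERIV_imp_deriv[OF DERIV_divide[OF fdd fd Dz(1)]])
    hence eq: "deriv (deriv f) z / f z = deriv D z + (D z)\<^sup>2"
      using Dz(1) by (simp add: D_def divide_simps power2_eq_square)
    have "norm (deriv (deriv f) z / f z) \<le> norm (deriv D z) + (norm (D z))\<^sup>2"
      unfolding eq by (metis norm_power norm_triangle_ineq)
    also have "\<dots> \<le> 768 * \<Lambda> ^ 3 + (48 * \<Lambda>\<^sup>2)\<^sup>2" using dD Db by (intro add_mono power_mono) auto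
    also have "\<dots> \<le> 768 * \<Lambda> ^ 4 + 2304 * \<Lambda> ^ 4"
      using power_increasing[of 3 4 \<Lambda>] \<Lambda>1 by (simp add: power_mult_distrib flip: power_mult)
    also have "\<dots> \<le> 4000 * \<Lambda> ^ 4" using \<Lambda>1 by simp
    finally have 2: "norm (deriv (deriv f) z / f z) \<le> 4000 * \<Lambda> ^ 4" .
    have "norm (deriv f z / f z) \<le> 48 * \<Lambda>\<^sup>2" using Db by (simp add: D_def)
    also have "\<dots> \<le> 4000 * \<Lambda> ^ 4" using power_increasing[of 2 4 \<Lambda>] \<Lambda>1 by (intro mult_mono) auto
    finally show ?thesis using 2 Dz(1) by blast
  qed
  show thesis using that \<Lambda>1 t(1,2) main by blast
qed

text \<open>
  The estimate on circles is applied to \<open>f\<close> recentred at a point \<open>c\<close> where it does not vanish. For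
  finite order the quantity \<open>\<Lambda>\<close> grows at most like a power of the distance.
\<close>

lemma log_derivatives_polynomially_bounded:
  fixes f :: "complex \<Rightarrow> complex"
  assumes holf: "f holomorphic_on UNIV" and fc: "f c \<noteq> 0"
    and growth: "\<And>z. norm z \<ge> R0 \<Longrightarrow> norm (f z) \<le> exp (norm z ^ K)"
  shows "\<exists>(m::nat) R1. R1 > 1 \<and> (\<forall>z0. norm z0 \<ge> R1 \<longrightarrow> (\<exists>t. 0 < t \<and> t < 1 \<and>
      (\<forall>z. norm (z - z0) = t \<longrightarrow> f z \<noteq> 0 \<and>
         norm (deriv f z / f z) \<le> norm z0 ^ m \<and> norm (deriv (deriv f) z / f z) \<le> norm z0 ^ m)))"
proof -
  define C where "C = 13 ^ K + \<bar>ln (norm (f c))\<bar> + 1"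
  have C: "C \<ge> 1" by (simp add: C_def)
  define R1 where "R1 = max (max 2 R0) (max (24 + 14 * norm c) (4000 * C ^ 4))"
  define F where "F = (\<lambda>z. f (z + c))"
  have holF: "F holomorphic_on UNIV"
  proof -
    have "f \<circ> (\<lambda>z. z + c) holomorphic_on UNIV"
      by (rule holomorphic_on_compose_gen[OF _ holf]) (auto intro!: holomorphic_intros)
    thus ?thesis by (simp add: o_def F_def)
  qed
  have shift: "deriv (\<lambda>z. h (z + c)) z = deriv h (z + c)" if "h holomorphic_on UNIV" for h :: "complex \<Rightarrow> complex" and z
    using that holomorphic_derivI[of h UNIV "z + c"] by (intro DERIV_imp_deriv) (simp flip: DERIV_shift)
  have dF: "deriv F = (\<lambda>z. deriv f (z + c))"
    unfolding F_def using shift[OF holf] by auto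
  have ddF: "deriv (deriv F) z = deriv (deriv f) (z + c)" for z
    unfolding dF by (rule shift[OF holomorphic_deriv[OF holf]]) simp
  show ?thesis
  proof (rule exI[of _ "4 * K + 1"], rule exI[of _ R1], intro conjI allI impI)
    show "R1 > 1" by (auto simp: R1_def)
    fix z0 :: complex assume z0: "norm z0 \<ge> R1"
    define r where "r = norm z0"
    have r: "r \<ge> 2" "r \<ge> R0" "r \<ge> 24 + 14 * norm c" "r \<ge> 4000 * C ^ 4" using z0 by (auto simp: R1_def r_def)
    define s where "s = 4 * (norm (z0 - c) + 2)"
    have s12: "3 * s = 12 * norm (z0 - c) + 24" by (simp add: s_def)
    have s1: "3 * s + norm c \<le> 13 * r"
    proof -
      have "norm (z0 - c) \<le> r + norm c" unfolding r_def by (rule norm_triangle_ineq4)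
      thus ?thesis using r(3) norm_ge_zero[of c] s12 by linarith
    qed
    have s2: "3 * s - norm c \<ge> r"
    proof -
      have "norm (z0 - c) \<ge> r - norm c" unfolding r_def by (rule norm_triangle_ineq2)
      thus ?thesis using r(3) norm_ge_zero[of c] s12 by linarith
    qed
    define M where "M = exp ((13 * r) ^ K)"
    have M: "norm (F z) \<le> M" if "norm z = 3 * s" for z
    proof -
      have l: "norm (z + c) \<ge> r" using norm_diff_ineq[of z c] that s2 by linarith
      have "norm (z + c) \<le> 13 * r" using norm_triangle_ineq[of z c] that s1 by linarith
      hence "norm (z + c) ^ K \<le> (13 * r) ^ K" by (intro power_mono) auto
      moreover have "norm (f (z + c)) \<le> exp (norm (z + c) ^ K)" by (rule growth) (use l r in linarith)
      ultimately show ?thesis unfolding M_def F_def by (meson exp_le_cancel_iff order_trans)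
    qed
    obtain t where L0: "ln (M / norm (F 0)) + 1 \<ge> 1" and t: "0 < t" "t < 1" "\<And>z. norm (z - (z0 - c)) = t \<Longrightarrow> F z \<noteq> 0 \<and>
        norm (deriv F z / F z) \<le> 4000 * (ln (M / norm (F 0)) + 1) ^ 4 \<and>
        norm (deriv (deriv F) z / F z) \<le> 4000 * (ln (M / norm (F 0)) + 1) ^ 4"
      by (rule log_derivatives_on_circle[OF holF, of "z0 - c" s M])
         (use fc M in \<open>auto simp: F_def s_def\<close>)
    have "ln (M / norm (F 0)) + 1 = (13 * r) ^ K - ln (norm (f c)) + 1"
      using fc by (simp add: M_def F_def ln_div)
    also have "\<dots> \<le> 13 ^ K * r ^ K + (\<bar>ln (norm (f c))\<bar> + 1) * r ^ K"
    proof -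
      have "(\<bar>ln (norm (f c))\<bar> + 1) * 1 \<le> (\<bar>ln (norm (f c))\<bar> + 1) * r ^ K"
        using r by (intro mult_left_mono) (auto intro!: one_le_power)
      thus ?thesis by (simp add: power_mult_distrib)
    qed
    also have "\<dots> = C * r ^ K" by (simp add: C_def algebra_simps)
    finally have L: "ln (M / norm (F 0)) + 1 \<le> C * r ^ K" .
    have "4000 * (ln (M / norm (F 0)) + 1) ^ 4 \<le> 4000 * (C * r ^ K) ^ 4"
      using L L0 by (intro mult_left_mono power_mono) auto
    also have "\<dots> = (4000 * C ^ 4) * r ^ (4 * K)"
      by (simp add: power_mult_distrib power_mult[symmetric] mult.commute)
    also have "\<dots> \<le> r * r ^ (4 * K)" using r by (intro mult_right_mono) auto
    finally have bd: "4000 * (ln (M / norm (F 0)) + 1) ^ 4 \<le> r ^ (4 * K + 1)" by simp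
    show "\<exists>t. 0 < t \<and> t < 1 \<and> (\<forall>z. norm (z - z0) = t \<longrightarrow> f z \<noteq> 0 \<and>
         norm (deriv f z / f z) \<le> norm z0 ^ (4 * K + 1) \<and> norm (deriv (deriv f) z / f z) \<le> norm z0 ^ (4 * K + 1))"
    proof (intro exI[of _ t] conjI allI impI)
      fix z assume z: "norm (z - z0) = t"
      hence "norm ((z - c) - (z0 - c)) = t" by simp
      from t(3)[OF this, unfolded ddF] bd
      show "f z \<noteq> 0" "norm (deriv f z / f z) \<le> norm z0 ^ (4 * K + 1)"
        "norm (deriv (deriv f) z / f z) \<le> norm z0 ^ (4 * K + 1)"
        unfolding dF by (simp_all add: F_def r_def)
    qed (use t in auto)
  qed
qed

section \<open>Elementary factors\<close>

lemma norm_weierstrass_factor_le: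
  "norm (weierstrass_factor q u) \<le> (1 + norm u) * exp (\<Sum>k=1..q. norm u ^ k)"
proof -
  have "norm (\<Sum>k=1..q. u ^ k / of_nat k) \<le> (\<Sum>k=1..q. norm u ^ k)"
  proof (intro order_trans[OF norm_sum] sum_mono)
    fix k assume "k \<in> {1..q}"
    hence "norm u ^ k / real k \<le> norm u ^ k / 1" by (intro divide_left_mono) auto
    thus "norm (u ^ k / of_nat k) \<le> norm u ^ k" by (simp add: norm_divide norm_power)
  qed
  hence "norm (exp (\<Sum>k=1..q. u ^ k / of_nat k)) \<le> exp (\<Sum>k=1..q. norm u ^ k)"
    by (intro order_trans[OF norm_exp]) simp
  thus ?thesis unfolding weierstrass_factor_def norm_mult
    using norm_triangle_ineq4[of 1 u] by (intro mult_mono) auto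
qed

text \<open>
  For small \<open>u\<close> the factor is \<open>1 + O(u^(q+1))\<close>. Where \<open>\<bar>u\<bar> \<ge> 1/2\<close>, lower powers of \<open>\<bar>u\<bar>\<close> are
  bounded by multiples of \<open>\<bar>u\<bar>^(q+1)\<close>.
\<close>

lemma norm_weierstrass_factor_le_exp:
  "norm (weierstrass_factor q u) \<le> exp ((3 + real (q + 1) * 2 ^ (q + 1)) * norm u ^ (q + 1))"
proof (cases "norm u \<le> 1/2")
  case True
  have "norm (weierstrass_factor q u) \<le> 1 + 3 * norm u ^ (q + 1)"
    using weierstrass_factor_bound[OF True, of q] norm_triangle_sub[of "weierstrass_factor q u" 1] by simp
  also have "\<dots> \<le> exp (3 * norm u ^ (q + 1))" by (rule exp_ge_add_one_self)
  also have "\<dots> \<le> exp ((3 + real (q + 1) * 2 ^ (q + 1)) * norm u ^ (q + 1))"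
    by (simp add: mult_right_mono)
  finally show ?thesis .
next
  case False
  have pw: "norm u ^ k \<le> 2 ^ (q + 1) * norm u ^ (q + 1)" if "k \<le> q" for k
  proof -
    have "norm u ^ k = (1/2) ^ (q + 1 - k) * (2 ^ (q + 1 - k) * norm u ^ k)" by (simp add: power_divide)
    also have "\<dots> \<le> norm u ^ (q + 1 - k) * (2 ^ (q + 1) * norm u ^ k)"
      using False by (intro mult_mono power_mono mult_right_mono power_increasing) auto
    also have "\<dots> = 2 ^ (q + 1) * norm u ^ (q + 1)"
      using that by (simp add: mult_ac flip: power_add)
    finally show ?thesis .
  qed
  have one: "norm u \<le> 2 ^ (q + 1) * norm u ^ (q + 1)"
  proof (cases "q = 0")
    case False thus ?thesis using pw[of 1] by simp
  qed simp
  have "norm (weierstrass_factor q u) \<le> (1 + norm u) * exp (\<Sum>k=1..q. norm u ^ k)"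
    by (rule norm_weierstrass_factor_le)
  also have "\<dots> \<le> exp (norm u) * exp (\<Sum>k=1..q. norm u ^ k)"
    by (intro mult_right_mono exp_ge_add_one_self) auto
  also have "\<dots> = exp (norm u + (\<Sum>k=1..q. norm u ^ k))" by (simp add: exp_add)
  also have "\<dots> \<le> exp (2 ^ (q + 1) * norm u ^ (q + 1) + (\<Sum>k=1..q. 2 ^ (q + 1) * norm u ^ (q + 1)))"
    unfolding exp_le_cancel_iff by (intro add_mono one sum_mono pw) auto
  also have "\<dots> = exp (real (q + 1) * 2 ^ (q + 1) * norm u ^ (q + 1))" by (simp add: algebra_simps)
  also have "\<dots> \<le> exp ((3 + real (q + 1) * 2 ^ (q + 1)) * norm u ^ (q + 1))"
    by (simp add: mult_right_mono)
  finally show ?thesis .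
qed

lemma one_plus_le_exp:
  fixes x e :: real
  assumes "x \<ge> 0" "e > 0"
  shows "1 + x \<le> exp (e * x + (e - ln e))"
proof -
  have "e * (1 + x) \<le> exp (e * (1 + x))" using exp_ge_add_one_self[of "e * (1 + x)"] by linarith
  hence "1 + x \<le> exp (e * (1 + x)) / exp (ln e)" using assms by (simp add: pos_le_divide_eq mult.commute)
  thus ?thesis by (simp add: exp_diff[symmetric] algebra_simps)
qed

lemma power_le_eps_power:
  fixes x e :: real
  assumes "x \<ge> 0" "e > 0" "k \<le> q"
  shows "x ^ k \<le> e * x ^ (q + 1) + max 1 (1 / e) ^ q"
proof (cases "x \<ge> max 1 (1 / e)")
  case True
  have "x ^ k \<le> x ^ q" using True assms by (intro power_increasing) auto
  also have "\<dots> \<le> (e * x) * x ^ q"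
  proof -
    have "1 \<le> e * x" using True assms by (simp add: field_simps)
    thus ?thesis using assms mult_right_mono[of 1 "e * x" "x ^ q"] by simp
  qed
  also have "\<dots> = e * x ^ (q + 1)" by simp
  also have "\<dots> \<le> \<dots> + max 1 (1 / e) ^ q" using assms by simp
  finally show ?thesis .
next
  case False
  have "x ^ k \<le> max 1 (1 / e) ^ k" using False assms by (intro power_mono) auto
  also have "\<dots> \<le> max 1 (1 / e) ^ q" using assms by (intro power_increasing) auto
  also have "\<dots> \<le> e * x ^ (q + 1) + \<dots>" using assms by simp
  finally show ?thesis .
qed

text \<open>
  A single factor grows more slowly than any \<open>exp (e * \<bar>u\<bar>^(q+1))\<close>, because the exponent in it only has
  degree \<open>q\<close>. For a finite number of factors the coefficient of \<open>\<bar>z\<bar>^(q+1)\<close> is therefore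
  arbitrarily small.
\<close>

lemma norm_weierstrass_factor_small_growth:
  assumes "e > 0"
  shows "\<exists>C\<ge>0. \<forall>u. norm (weierstrass_factor q u) \<le> exp (e * norm u ^ (q + 1) + C)"
proof -
  define \<eta> where "\<eta> = e / (2 * real (q + 1))"
  have \<eta>: "\<eta> > 0" using assms by (simp add: \<eta>_def)
  have \<eta>2: "\<eta> + real q * \<eta> \<le> e"
  proof -
    have "\<eta> + real q * \<eta> = real (q + 1) * \<eta>" by (simp add: algebra_simps)
    also have "\<dots> = e / 2"
    proof -
      have "a * (e / (2 * a)) = e / 2" if "a > 0" for a :: real using that by simp
      from this[of "real (q + 1)"] show ?thesis unfolding \<eta>_def by simp
    qed
    finally show ?thesis using assms by simp
  qed
  define C where "C = \<bar>2 * \<eta> - ln \<eta>\<bar> + real q * max 1 (1 / \<eta>) ^ q"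
  have "norm (weierstrass_factor q u) \<le> exp (e * norm u ^ (q + 1) + C)" for u
  proof -
    define x where "x = norm u"
    have x: "x \<ge> 0" by (simp add: x_def)
    have x1: "x \<le> x ^ (q + 1) + 1"
    proof (cases "x \<le> 1")
      case False
      hence "x ^ 1 \<le> x ^ (q + 1)" by (intro power_increasing) auto
      thus ?thesis by simp
    qed (use x in \<open>simp add: add_increasing\<close>)
    have "norm (weierstrass_factor q u) \<le> (1 + x) * exp (\<Sum>k=1..q. x ^ k)"
      unfolding x_def by (rule norm_weierstrass_factor_le)
    also have "\<dots> \<le> exp (\<eta> * x + (\<eta> - ln \<eta>)) * exp (\<Sum>k=1..q. \<eta> * x ^ (q + 1) + max 1 (1 / \<eta>) ^ q)"
    proof (intro mult_mono one_plus_le_exp)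
      show "exp (\<Sum>k=1..q. x ^ k) \<le> exp (\<Sum>k=1..q. \<eta> * x ^ (q + 1) + max 1 (1 / \<eta>) ^ q)"
        unfolding exp_le_cancel_iff by (rule sum_mono, rule power_le_eps_power[OF x \<eta>]) simp
    qed (use x \<eta> in auto)
    also have "\<dots> = exp (\<eta> * x + (\<eta> - ln \<eta>) + real q * (\<eta> * x ^ (q + 1) + max 1 (1 / \<eta>) ^ q))"
      by (simp add: exp_add)
    also have "\<dots> \<le> exp (e * x ^ (q + 1) + C)"
    proof -
      have "\<eta> * x \<le> \<eta> * (x ^ (q + 1) + 1)" using x1 \<eta> by (intro mult_left_mono) auto
      moreover have "(\<eta> + real q * \<eta>) * x ^ (q + 1) \<le> e * x ^ (q + 1)"
        using \<eta>2 x by (intro mult_right_mono) auto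
      moreover have "2 * \<eta> - ln \<eta> \<le> \<bar>2 * \<eta> - ln \<eta>\<bar>" by simp
      ultimately show ?thesis unfolding C_def exp_le_cancel_iff
        by (simp only: ring_distribs mult.assoc)
    qed
    finally show ?thesis by (simp add: x_def)
  qed
  moreover have "C \<ge> 0" by (simp add: C_def)
  ultimately show ?thesis by blast
qed

text \<open>
  Along the ray with argument \<open>\<phi>\<close>, the logarithm of the factor has the derivative
  \<open>- cis \<phi> * u^q / (1 - u)\<close>. After multiplication by the conjugate of \<open>1 - u\<close>, its real part is
  \<open>- t^q (cos ((q + 1) \<phi>) - t cos (q \<phi>)) / \<bar>1 - u\<bar>\<^sup>2\<close>, which the two sign conditions make at most
  \<open>- \<delta> t^(q+1) / (1 + t)\<^sup>2\<close>. The first claim is monotonicity, and the second follows by integration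
  from 1.
\<close>

lemma weierstrass_factor_in_sector:
  assumes q: "q \<ge> 1" and c1: "cos (real (q + 1) * \<phi>) \<ge> 0" and c2: "cos (real q * \<phi>) \<le> - \<delta>"
    and \<delta>: "\<delta> > 0" and s: "s \<ge> 0"
  shows "norm (weierstrass_factor q (of_real s * cis \<phi>)) \<le> 1"
    and "s \<ge> 2 \<Longrightarrow> norm (weierstrass_factor q (of_real s * cis \<phi>)) \<le> exp (- (\<delta> / (8 * real q)) * s ^ q)"
proof -
  \<comment> \<open>the ray avoids the branch cut of the logarithm: otherwise \<open>\<phi>\<close> would be a multiple of \<open>2 pi\<close>\<close>
  have cut: "1 - of_real t * cis \<phi> \<notin> \<real>\<^sub>\<le>\<^sub>0" if "t \<ge> 0" for t
  proof
    assume "1 - of_real t * cis \<phi> \<in> \<real>\<^sub>\<le>\<^sub>0"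
    hence "t * sin \<phi> = 0" "t * cos \<phi> \<ge> 1" by (auto simp: complex_nonpos_Reals_iff)
    hence "sin \<phi> = 0" "cos \<phi> > 0" using that by (auto simp: zero_less_mult_iff dest: less_le_trans[OF zero_less_one])
    hence "cos \<phi> = 1" using sin_cos_squared_add[of \<phi>] by (auto simp: power2_eq_1_iff)
    hence "cis \<phi> = 1" using \<open>sin \<phi> = 0\<close> by (simp add: complex_eq_iff)
    hence "cis (real q * \<phi>) = 1" using Complex.DeMoivre[of \<phi> q] by simp
    hence "cos (real q * \<phi>) = 1" by (simp add: complex_eq_iff)
    thus False using c2 \<delta> by simp
  qed
  define G where "G = (\<lambda>z. Ln (1 - z * cis \<phi>) + (\<Sum>k=1..q. (z * cis \<phi>) ^ k / of_nat k))"
  define g where "g = (\<lambda>t::real. Re (G (of_real t)))"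
  have norm_eq: "norm (weierstrass_factor q (of_real t * cis \<phi>)) = exp (g t)" if "t \<ge> 0" for t
  proof -
    have "1 - of_real t * cis \<phi> \<noteq> 0" using cut[OF that] by auto
    hence "weierstrass_factor q (of_real t * cis \<phi>) = exp (G (of_real t))"
      by (simp add: weierstrass_factor_def G_def exp_add)
    thus ?thesis by (simp add: g_def)
  qed
  have deriv: "\<exists>D. (g has_real_derivative D) (at t) \<and> D \<le> - \<delta> * t ^ (q + 1) / (1 + t)\<^sup>2"
    if t: "t \<ge> 0" for t
  proof -
    define u where "u = of_real t * cis \<phi>"
    have nz: "1 - u \<noteq> 0" using cut[OF t] unfolding u_def by auto
    define D where "D = - cis \<phi> * u ^ q / (1 - u)"
    have "(G has_field_derivative (- cis \<phi> / (1 - u) + (\<Sum>k=1..q. u ^ (k - 1) * cis \<phi>))) (at (of_real t))"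
      unfolding G_def
    proof (intro DERIV_add DERIV_sum)
      show "((\<lambda>z. Ln (1 - z * cis \<phi>)) has_field_derivative (- cis \<phi> / (1 - u))) (at (of_real t))"
        using cut[OF t] nz unfolding u_def
        by (auto intro!: derivative_eq_intros simp: field_simps)
      show "((\<lambda>z. (z * cis \<phi>) ^ k / of_nat k) has_field_derivative u ^ (k - 1) * cis \<phi>) (at (of_real t))"
        if "k \<in> {1..q}" for k
      proof -
        obtain j where j: "k = Suc j" using \<open>k \<in> {1..q}\<close> by (cases k) auto
        have "((\<lambda>z. z * cis \<phi>) has_field_derivative cis \<phi>) (at (of_real t))"
          by (auto intro!: derivative_eq_intros)
        from DERIV_cdivide[OF DERIV_power[OF this, of "Suc j"], of "of_nat (Suc j)"]
        show ?thesis unfolding u_def j by (simp add: mult_ac del: of_nat_Suc)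
      qed
    qed
    also have "- cis \<phi> / (1 - u) + (\<Sum>k=1..q. u ^ (k - 1) * cis \<phi>) = D"
    proof -
      have "(\<Sum>k=1..q. u ^ (k - 1) * cis \<phi>) = (\<Sum>k<q. u ^ k) * cis \<phi>"
        unfolding sum_distrib_right by (rule sum.reindex_bij_witness[of _ Suc "\<lambda>k. k - 1"]) auto
      also have "(\<Sum>k<q. u ^ k) = (1 - u ^ q) / (1 - u)" using nz by (subst sum_gp_strict) auto
      finally have S: "(\<Sum>k=1..q. u ^ (k - 1) * cis \<phi>) = (1 - u ^ q) / (1 - u) * cis \<phi>" .
      have "- c / v + (1 - w) / v * c = - c * w / v" if "v \<noteq> 0" for c v w :: complex
        using that by (simp add: divide_simps) (simp add: algebra_simps)
      from this[OF nz] show ?thesis unfolding S D_def .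
    qed
    finally have "((\<lambda>t. G (of_real t)) has_vector_derivative D) (at t)"
      by (rule has_vector_derivative_real_field)
    hence "(g has_vector_derivative Re D) (at t)"
      unfolding g_def by (rule bounded_linear.has_vector_derivative[OF bounded_linear_Re])
    hence gd: "(g has_real_derivative Re D) (at t)" by (simp add: has_real_derivative_iff_has_vector_derivative)
    have "D = - of_real (t ^ q) * (cis (real (q + 1) * \<phi>) / (1 - u))"
      by (simp add: D_def u_def power_mult_distrib Complex.DeMoivre cis_mult algebra_simps)
    also have "cis (real (q + 1) * \<phi>) / (1 - u) = (cis (real (q + 1) * \<phi>) * cnj (1 - u)) / of_real ((norm (1 - u))\<^sup>2)"
      by (rule complex_div_cnj)
    also have "cis (real (q + 1) * \<phi>) * cnj (1 - u) = cis (real (q + 1) * \<phi>) - of_real t * cis (real q * \<phi>)"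
      by (simp add: u_def algebra_simps cis_cnj cis_mult)
    finally have "Re D = - (t ^ q) * ((cos (real (q + 1) * \<phi>) - t * cos (real q * \<phi>)) / (norm (1 - u))\<^sup>2)"
      by (simp add: Re_divide_of_real del: of_real_power of_nat_add of_nat_Suc)
    also have "\<dots> \<le> - (t ^ q) * ((t * \<delta>) / (1 + t)\<^sup>2)"
    proof (intro mult_left_mono_neg frac_le)
      have "t * cos (real q * \<phi>) \<le> t * (- \<delta>)" using c2 t by (intro mult_left_mono) auto
      thus "t * \<delta> \<le> cos (real (q + 1) * \<phi>) - t * cos (real q * \<phi>)" using c1 by simp
      thus "0 \<le> cos (real (q + 1) * \<phi>) - t * cos (real q * \<phi>)" using t \<delta> mult_nonneg_nonneg[of t \<delta>] by linarith
      have "norm (1 - u) \<le> 1 + t" using norm_triangle_ineq4[of 1 u] t by (simp add: u_def norm_mult)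
      thus "(norm (1 - u))\<^sup>2 \<le> (1 + t)\<^sup>2" by (intro power_mono) auto
    qed (use t nz in auto)
    finally show ?thesis using gd by (intro exI[of _ "Re D"]) (simp add: mult_ac)
  qed
  have g0: "g 0 = 0" using q by (simp add: g_def G_def power_0_left)
  have g_le: "g t \<le> 0" if t: "t \<ge> 0" for t
  proof -
    have "g t \<le> g 0"
    proof (rule DERIV_nonpos_imp_nonincreasing[OF t])
      fix x assume x: "0 \<le> x" "x \<le> t"
      obtain D where "(g has_real_derivative D) (at x)" "D \<le> - \<delta> * x ^ (q + 1) / (1 + x)\<^sup>2"
        using deriv[OF x(1)] by blast
      moreover have "- \<delta> * x ^ (q + 1) / (1 + x)\<^sup>2 \<le> 0" using x \<delta> by (simp add: divide_nonpos_nonneg)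
      ultimately show "\<exists>y. (g has_real_derivative y) (at x) \<and> y \<le> 0" using order_trans by blast
    qed
    thus ?thesis using g0 by simp
  qed
  show "norm (weierstrass_factor q (of_real s * cis \<phi>)) \<le> 1" using norm_eq[OF s] g_le[OF s] by simp
  assume s2: "s \<ge> 2"
  define \<kappa> where "\<kappa> = \<delta> / (4 * real q)"
  have \<kappa>: "\<kappa> > 0" using \<delta> q by (simp add: \<kappa>_def)
  have "g s + \<kappa> * s ^ q \<le> g 1 + \<kappa> * 1 ^ q"
  proof (rule DERIV_nonpos_imp_nonincreasing[where f = "\<lambda>s. g s + \<kappa> * s ^ q"])
    fix x assume x: "1 \<le> x" "x \<le> s"
    obtain D where D: "(g has_real_derivative D) (at x)" "D \<le> - \<delta> * x ^ (q + 1) / (1 + x)\<^sup>2"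
      using deriv[of x] x by auto
    have "(1 + x)\<^sup>2 \<le> (2 * x)\<^sup>2" using x by (intro power_mono) auto
    hence "\<delta> * x ^ (q + 1) / (2 * x)\<^sup>2 \<le> \<delta> * x ^ (q + 1) / (1 + x)\<^sup>2"
      using x \<delta> by (intro divide_left_mono) (auto intro!: mult_pos_pos)
    also have "\<delta> * x ^ (q + 1) / (2 * x)\<^sup>2 = \<delta> / 4 * x ^ (q - 1)"
      using x q by (cases q) (auto simp: power2_eq_square)
    finally have "D + \<kappa> * (real q * x ^ (q - 1)) \<le> 0" using D(2) q by (simp add: \<kappa>_def)
    moreover have "((\<lambda>s. g s + \<kappa> * s ^ q) has_real_derivative D + \<kappa> * (real q * x ^ (q - 1))) (at x)"
      by (auto intro!: derivative_eq_intros D(1))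
    ultimately show "\<exists>y. ((\<lambda>s. g s + \<kappa> * s ^ q) has_real_derivative y) (at x) \<and> y \<le> 0" by blast
  qed (use s2 in auto)
  hence "g s \<le> \<kappa> - \<kappa> * s ^ q" using g_le[of 1] by simp
  also have "\<dots> \<le> - (\<kappa> / 2) * s ^ q"
  proof -
    have "2 \<le> s ^ q" using s2 q self_le_power[of s q] by simp
    hence "\<kappa> * 2 \<le> \<kappa> * s ^ q" using \<kappa> by (intro mult_left_mono) auto
    thus ?thesis by simp
  qed
  finally show "norm (weierstrass_factor q (of_real s * cis \<phi>)) \<le> exp (- (\<delta> / (8 * real q)) * s ^ q)"
    using norm_eq[OF s] by (simp add: \<kappa>_def)
qed

section \<open>Canonical products\<close>

text \<open>
  Canonical products over a family that is indexed by an arbitrary set of naturals; the factors with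
  index outside that set are 1, so that finite and infinite families are treated alike.
\<close>

locale genus_product =
  fixes I :: "nat set" and a :: "nat \<Rightarrow> complex" and q :: nat
  assumes a_nz: "\<And>n. n \<in> I \<Longrightarrow> a n \<noteq> 0"
    and summable_a: "(\<lambda>n. 1 / norm (a n) ^ (q + 1)) summable_on I"
begin

definition elem_factor :: "nat \<Rightarrow> complex \<Rightarrow> complex" where
  "elem_factor n z = (if n \<in> I then weierstrass_factor q (z / a n) else 1)"

definition weight :: "nat \<Rightarrow> real" where
  "weight n = (if n \<in> I then 1 / norm (a n) ^ (q + 1) else 0)"

lemma weight_nonneg: "weight n \<ge> 0" by (simp add: weight_def)

lemma summable_weight: "summable weight"
proof -
  have "weight summable_on UNIV"
    by (rule summable_on_cong_neutral[THEN iffD1, OF _ _ _ summable_a]) (auto simp: weight_def)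
  thus ?thesis by (subst (asm) summable_on_UNIV_nonneg_real_iff) (auto simp: weight_nonneg)
qed

lemma weight_power: "n \<in> I \<Longrightarrow> norm (z / a n) ^ (q + 1) = norm z ^ (q + 1) * weight n"
  by (simp add: weight_def norm_divide power_divide)

lemma partial_products_tendsto: "(\<lambda>N. \<Prod>n\<le>N. elem_factor n z) \<longlonglongrightarrow> (\<Prod>n. elem_factor n z)"
proof -
  have "(\<lambda>n. norm z ^ (q + 1) * weight n) \<longlonglongrightarrow> 0"
    using tendsto_mult_right_zero[OF summable_LIMSEQ_zero[OF summable_weight]] by simp
  hence "eventually (\<lambda>n. norm z ^ (q + 1) * weight n < (1/2) ^ (q + 1)) sequentially"
    by (rule order_tendstoD) simp
  then obtain N where N: "\<And>n. n \<ge> N \<Longrightarrow> norm z ^ (q + 1) * weight n < (1/2) ^ (q + 1)"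
    unfolding eventually_sequentially by blast
  have "norm (norm (elem_factor n z - 1)) \<le> 3 * norm z ^ (q + 1) * weight n" if "n \<ge> N" for n
  proof (cases "n \<in> I")
    case True
    have "norm (z / a n) ^ (q + 1) < (1/2) ^ (q + 1)" using N[OF that] by (simp only: weight_power[OF True])
    hence "norm (z / a n) < 1/2" by (rule power_less_imp_less_base) simp
    hence "norm (elem_factor n z - 1) \<le> 3 * norm (z / a n) ^ Suc q"
      using weierstrass_factor_bound[of "z / a n" q] True by (simp add: elem_factor_def)
    thus ?thesis using weight_power[OF True, of z] by (simp add: mult.assoc)
  qed (simp add: elem_factor_def weight_def)
  hence "summable (\<lambda>n. norm (elem_factor n z - 1))"
    by (intro summable_comparison_test[OF _ summable_mult[OF summable_weight]]) blast
  hence "convergent_prod (\<lambda>n. elem_factor n z)"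
    by (intro abs_convergent_prod_imp_convergent_prod summable_imp_abs_convergent_prod)
  thus ?thesis by (rule convergent_prod_LIMSEQ)
qed

lemma norm_product_le:
  assumes "\<And>N. N \<ge> N0 \<Longrightarrow> (\<Prod>n\<le>N. norm (elem_factor n z)) \<le> X"
  shows "norm (\<Prod>n. elem_factor n z) \<le> X"
proof -
  have "(\<lambda>N. norm (\<Prod>n\<le>N. elem_factor n z)) \<longlonglongrightarrow> norm (\<Prod>n. elem_factor n z)"
    by (rule tendsto_norm[OF partial_products_tendsto])
  thus ?thesis by (rule LIMSEQ_le_const2) (use assms in \<open>auto simp: prod_norm\<close>)
qed

text \<open>
  The partial products at \<open>a k\<close> vanish from the index \<open>k\<close> on. Thus the points \<open>a k\<close> are zeros of the
  function itself, which is what places them in the sector.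
\<close>

lemma product_zero:
  assumes "k \<in> I"
  shows "(\<Prod>n. elem_factor n (a k)) = 0"
proof -
  have "norm (\<Prod>n. elem_factor n (a k)) \<le> 0"
  proof (rule norm_product_le[of k])
    fix N assume "N \<ge> k"
    moreover have "elem_factor k (a k) = 0" using assms a_nz[OF assms] by (simp add: elem_factor_def)
    ultimately have "(\<Prod>n\<le>N. norm (elem_factor n (a k))) = 0"
      by (intro prod_zero[OF finite_atMost]) (auto intro!: bexI[of _ k])
    thus "(\<Prod>n\<le>N. norm (elem_factor n (a k))) \<le> 0" by (rule eq_refl)
  qed
  thus ?thesis by simp
qed

lemma finite_product_small_growth:
  "e > 0 \<Longrightarrow> \<exists>C\<ge>0. \<forall>z. (\<Prod>n<N. norm (elem_factor n z)) \<le> exp (e * norm z ^ (q + 1) + C)"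
proof (induction N arbitrary: e)
  case 0
  thus ?case by (intro exI[of _ 0]) auto
next
  case (Suc N)
  then obtain C1 where C1: "C1 \<ge> 0" "\<And>z. (\<Prod>n<N. norm (elem_factor n z)) \<le> exp (e/2 * norm z ^ (q + 1) + C1)"
    using Suc.IH[of "e/2"] by auto
  obtain C2 where C2: "C2 \<ge> 0" "\<And>z. norm (elem_factor N z) \<le> exp (e/2 * norm z ^ (q + 1) + C2)"
  proof (cases "N \<in> I")
    case True
    define \<eta> where "\<eta> = e / 2 * norm (a N) ^ (q + 1)"
    have "\<eta> > 0" using Suc.prems a_nz[OF True] by (simp add: \<eta>_def)
    then obtain C where C: "C \<ge> 0" "\<And>u. norm (weierstrass_factor q u) \<le> exp (\<eta> * norm u ^ (q + 1) + C)"
      using norm_weierstrass_factor_small_growth by blast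
    have eq: "\<eta> * norm (z / a N) ^ (q + 1) = e/2 * norm z ^ (q + 1)" for z
      unfolding weight_power[OF True] using True a_nz[OF True] by (simp add: \<eta>_def weight_def)
    have "norm (elem_factor N z) \<le> exp (e/2 * norm z ^ (q + 1) + C)" for z
      using C(2)[of "z / a N"] True unfolding eq by (simp add: elem_factor_def)
    thus ?thesis using that[of C] C(1) by blast
  next
    case False
    thus ?thesis using that[of 0] Suc.prems by (simp add: elem_factor_def)
  qed
  show ?case
  proof (intro exI[of _ "C1 + C2"] conjI allI)
    fix z
    have "(\<Prod>n<Suc N. norm (elem_factor n z)) \<le> exp (e/2 * norm z ^ (q + 1) + C1) * exp (e/2 * norm z ^ (q + 1) + C2)"
      unfolding prod.lessThan_Suc by (intro mult_mono C1 C2) auto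
    also have "\<dots> = exp (e * norm z ^ (q + 1) + (C1 + C2))"
      by (simp add: exp_add[symmetric])
    finally show "(\<Prod>n<Suc N. norm (elem_factor n z)) \<le> exp (e * norm z ^ (q + 1) + (C1 + C2))" .
  qed (use C1 C2 in auto)
qed

text \<open>
  The tail of the convergent sum of \<open>weight\<close> contributes at most \<open>e/2\<close> to the coefficient of
  \<open>\<bar>z\<bar>^(q+1)\<close>; each of the finitely many remaining factors grows more slowly than that power.
\<close>

lemma product_small_growth:
  assumes "e > 0"
  shows "\<exists>C\<ge>0. \<forall>z. norm (\<Prod>n. elem_factor n z) \<le> exp (e * norm z ^ (q + 1) + C)"
proof -
  define c where "c = 3 + real (q + 1) * 2 ^ (q + 1)"
  have c: "c > 0" by (simp add: c_def add_pos_nonneg)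
  have Fw: "norm (elem_factor n z) \<le> exp (c * norm z ^ (q + 1) * weight n)" for n z
  proof (cases "n \<in> I")
    case True
    thus ?thesis using norm_weierstrass_factor_le_exp[of q "z / a n"] unfolding weight_power[OF True] c_def
      by (simp add: elem_factor_def mult.assoc)
  qed (simp add: elem_factor_def weight_def)
  have "e / (2 * c) > 0" using assms c by simp
  then obtain N where N: "\<And>m n. m \<ge> N \<Longrightarrow> norm (sum weight {m..<n}) < e / (2 * c)"
    using summable_weight unfolding summable_Cauchy by metis
  obtain C where C: "C \<ge> 0" "\<And>z. (\<Prod>n<N. norm (elem_factor n z)) \<le> exp (e/2 * norm z ^ (q + 1) + C)"
    using finite_product_small_growth[of "e/2" N] assms by auto
  have "norm (\<Prod>n. elem_factor n z) \<le> exp (e * norm z ^ (q + 1) + C)" for z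
  proof (rule norm_product_le[of N])
    fix M assume "M \<ge> N"
    have "(\<Prod>n\<le>M. norm (elem_factor n z)) = (\<Prod>n<N. norm (elem_factor n z)) * (\<Prod>n\<in>{N..<Suc M}. norm (elem_factor n z))"
      using \<open>M \<ge> N\<close> by (subst prod.union_disjoint[symmetric]) (auto intro!: prod.cong)
    also have "\<dots> \<le> exp (e/2 * norm z ^ (q + 1) + C) * (\<Prod>n\<in>{N..<Suc M}. exp (c * norm z ^ (q + 1) * weight n))"
      by (intro mult_mono C prod_mono conjI Fw prod_nonneg) auto
    also have "(\<Prod>n\<in>{N..<Suc M}. exp (c * norm z ^ (q + 1) * weight n)) = exp (c * norm z ^ (q + 1) * sum weight {N..<Suc M})"
      by (simp only: exp_sum[OF finite_atLeastLessThan, symmetric] sum_distrib_left)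
    also have "\<dots> \<le> exp (e/2 * norm z ^ (q + 1))"
    proof -
      have "sum weight {N..<Suc M} \<le> e / (2 * c)" using N[of N "Suc M"] by (simp only: real_norm_def abs_less_iff) linarith
      hence "c * norm z ^ (q + 1) * sum weight {N..<Suc M} \<le> c * norm z ^ (q + 1) * (e / (2 * c))"
        using c by (intro mult_left_mono) auto
      thus ?thesis using c by (simp add: mult.commute)
    qed
    also have "exp (e/2 * norm z ^ (q + 1) + C) * exp (e/2 * norm z ^ (q + 1)) = exp (e * norm z ^ (q + 1) + C)"
      by (simp add: exp_add[symmetric])
    finally show "(\<Prod>n\<le>M. norm (elem_factor n z)) \<le> exp (e * norm z ^ (q + 1) + C)" by simp
  qed
  with C(1) show ?thesis by blast
qed

text \<open>
  The directions \<open>\<theta>\<close> are those for which \<open>\<theta> - t\<close> stays in a compact part \<open>K\<close> of the interval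
  \<open>(\<beta>1, \<beta>2)\<close> for every \<open>t\<close> between \<open>\<theta>1\<close> and \<open>\<theta>2\<close>; they exist because the interval is longer than the
  opening of the sector. Then all factors are at most 1, and the finitely many factors in a set \<open>S\<close>
  chosen from the divergent sum contribute a decay with any prescribed \<open>W\<close>.
\<close>

lemma product_decay_in_sector:
  assumes q: "q \<ge> 1" and div: "\<not> (\<lambda>n. 1 / norm (a n) ^ q) summable_on I"
    and arg: "\<And>n. n \<in> I \<Longrightarrow> \<exists>\<theta>. \<theta>1 < \<theta> \<and> \<theta> < \<theta>2 \<and> is_Arg (a n) \<theta>"
    and \<beta>: "\<And>\<phi>. \<beta>1 < \<phi> \<Longrightarrow> \<phi> < \<beta>2 \<Longrightarrow> cos (real (q + 1) * \<phi>) \<ge> 0 \<and> cos (real q * \<phi>) < 0"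
    and narrow: "\<theta>2 - \<theta>1 < \<beta>2 - \<beta>1"
  shows "\<exists>\<psi> \<alpha>. \<alpha> > 0 \<and> (\<forall>W. \<exists>R. \<forall>r\<ge>R. \<forall>\<theta>. \<psi> \<le> \<theta> \<and> \<theta> \<le> \<psi> + \<alpha> \<longrightarrow>
           norm (\<Prod>n. elem_factor n (of_real r * cis \<theta>)) \<le> exp (- W * r ^ q))"
proof -
  have "I \<noteq> {}" using div by auto
  hence \<theta>12: "\<theta>1 < \<theta>2" using arg by fastforce
  define d where "d = ((\<beta>2 - \<beta>1) - (\<theta>2 - \<theta>1)) / 4"
  have d: "d > 0" using narrow by (simp add: d_def)
  define K where "K = {\<beta>1 + d..\<beta>2 - d}"
  have \<beta>K: "\<beta>1 + d \<le> \<beta>2 - d" using \<theta>12 narrow by (simp add: d_def field_simps)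
  have "\<exists>\<phi>0\<in>K. \<forall>\<phi>\<in>K. cos (real q * \<phi>) \<le> cos (real q * \<phi>0)"
    unfolding K_def by (rule continuous_attains_sup) (use \<beta>K in \<open>auto intro!: continuous_intros\<close>)
  then obtain \<phi>0 where \<phi>0: "\<phi>0 \<in> K" "\<And>\<phi>. \<phi> \<in> K \<Longrightarrow> cos (real q * \<phi>) \<le> cos (real q * \<phi>0)" by blast
  define \<delta> where "\<delta> = - cos (real q * \<phi>0)"
  have \<delta>: "\<delta> > 0" using \<beta>[of \<phi>0] \<phi>0(1) d by (auto simp: \<delta>_def K_def)
  define \<kappa> where "\<kappa> = \<delta> / (8 * real q)"
  have \<kappa>: "\<kappa> > 0" using \<delta> q by (simp add: \<kappa>_def)
  define \<psi> where "\<psi> = \<beta>1 + d + \<theta>2"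
  show ?thesis
  proof (rule exI[of _ \<psi>], rule exI[of _ "2 * d"], intro conjI allI)
    fix W :: real
    obtain S where S: "finite S" "S \<subseteq> I" "(\<Sum>n\<in>S. 1 / norm (a n) ^ q) > W / \<kappa>"
    proof (rule ccontr)
      assume "\<not> thesis"
      hence "\<And>S. finite S \<Longrightarrow> S \<subseteq> I \<Longrightarrow> (\<Sum>n\<in>S. 1 / norm (a n) ^ q) \<le> W / \<kappa>"
        using that by force
      hence "(\<lambda>n. 1 / norm (a n) ^ q) summable_on I"
        by (intro nonneg_bdd_above_summable_on bdd_aboveI2[of _ _ "W / \<kappa>"]) auto
      thus False using div by simp
    qed
    define R where "R = 1 + (\<Sum>n\<in>S. 2 * norm (a n))"
    show "\<exists>R. \<forall>r\<ge>R. \<forall>\<theta>. \<psi> \<le> \<theta> \<and> \<theta> \<le> \<psi> + 2 * d \<longrightarrow>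
           norm (\<Prod>n. elem_factor n (of_real r * cis \<theta>)) \<le> exp (- W * r ^ q)"
    proof (intro exI[of _ R] allI impI)
      fix r \<theta> assume r: "r \<ge> R" and \<theta>: "\<psi> \<le> \<theta> \<and> \<theta> \<le> \<psi> + 2 * d"
      define z where "z = of_real r * cis \<theta>"
      have Rpos: "r > 0" using r sum_nonneg[of S "\<lambda>n. 2 * norm (a n)"] by (simp add: R_def)
      have factor: "norm (elem_factor n z) \<le> 1"
        "r \<ge> 2 * norm (a n) \<Longrightarrow> norm (elem_factor n z) \<le> exp (- \<kappa> * (r / norm (a n)) ^ q)" if n: "n \<in> I" for n
      proof -
        obtain t where t: "\<theta>1 < t" "t < \<theta>2" "is_Arg (a n) t" using arg[OF n] by blast
        have an: "a n = of_real (norm (a n)) * cis t"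
          using t(3) unfolding is_Arg_def by (simp add: cis_conv_exp mult.commute)
        have u: "z / a n = of_real (r / norm (a n)) * cis (\<theta> - t)"
          using a_nz[OF n] by (subst an) (simp add: z_def cis_divide[symmetric])
        have K: "\<theta> - t \<in> K"
        proof -
          have "4 * d = (\<beta>2 - \<beta>1) - (\<theta>2 - \<theta>1)" by (simp add: d_def)
          thus ?thesis using \<theta> t unfolding K_def \<psi>_def by auto
        qed
        have c1: "cos (real (q + 1) * (\<theta> - t)) \<ge> 0" using \<beta>[of "\<theta> - t"] K d by (auto simp: K_def)
        have c2: "cos (real q * (\<theta> - t)) \<le> - \<delta>" using \<phi>0(2)[OF K] by (simp add: \<delta>_def)
        have s: "r / norm (a n) \<ge> 0" using Rpos by simp
        show "norm (elem_factor n z) \<le> 1" using weierstrass_factor_in_sector(1)[OF q c1 c2 \<delta> s] n u by (simp add: elem_factor_def)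
        assume "r \<ge> 2 * norm (a n)"
        hence "r / norm (a n) \<ge> 2" using a_nz[OF n] by (simp add: pos_le_divide_eq)
        from weierstrass_factor_in_sector(2)[OF q c1 c2 \<delta> s this] n u
        show "norm (elem_factor n z) \<le> exp (- \<kappa> * (r / norm (a n)) ^ q)" by (simp add: elem_factor_def \<kappa>_def)
      qed
      have F1: "norm (elem_factor n z) \<le> 1" for n using factor(1)[of n] by (cases "n \<in> I") (auto simp: elem_factor_def)
      obtain N0 where N0: "S \<subseteq> {..N0}" using S(1) finite_nat_iff_bounded_le by blast
      have "norm (\<Prod>n. elem_factor n z) \<le> (\<Prod>n\<in>S. exp (- \<kappa> * (r / norm (a n)) ^ q))"
      proof (rule norm_product_le[of N0])
        fix N assume "N \<ge> N0"
        hence SN: "S \<subseteq> {..N}" using N0 by auto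
        have "(\<Prod>n\<le>N. norm (elem_factor n z)) = (\<Prod>n\<in>{..N} - S. norm (elem_factor n z)) * (\<Prod>n\<in>S. norm (elem_factor n z))"
          using SN by (intro prod.subset_diff) auto
        also have "\<dots> \<le> 1 * (\<Prod>n\<in>S. exp (- \<kappa> * (r / norm (a n)) ^ q))"
        proof (intro mult_mono prod_mono prod_le_1 conjI)
          fix n assume n: "n \<in> S"
          have "2 * norm (a n) \<le> (\<Sum>n\<in>S. 2 * norm (a n))" using S(1) n by (intro member_le_sum) auto
          hence "r \<ge> 2 * norm (a n)" using r by (simp add: R_def)
          thus "norm (elem_factor n z) \<le> exp (- \<kappa> * (r / norm (a n)) ^ q)" using factor(2)[of n] n S(2) by blast
        qed (auto simp: F1 intro!: prod_nonneg)
        finally show "(\<Prod>n\<le>N. norm (elem_factor n z)) \<le> (\<Prod>n\<in>S. exp (- \<kappa> * (r / norm (a n)) ^ q))" by simp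
      qed
      also have "\<dots> = exp (- (\<kappa> * (\<Sum>n\<in>S. 1 / norm (a n) ^ q)) * r ^ q)"
        by (simp add: exp_sum[OF S(1), symmetric] sum_distrib_left sum_distrib_right sum_negf power_divide mult_ac)
      also have "\<dots> \<le> exp (- W * r ^ q)"
      proof -
        have "W \<le> \<kappa> * (\<Sum>n\<in>S. 1 / norm (a n) ^ q)" using S(3) \<kappa> by (simp add: pos_divide_less_eq mult.commute)
        thus ?thesis using Rpos unfolding exp_le_cancel_iff by (intro mult_right_mono) auto
      qed
      finally show "norm (\<Prod>n. elem_factor n (of_real r * cis \<theta>)) \<le> exp (- W * r ^ q)" by (simp add: z_def)
    qed
  qed (use d in auto)
qed

end

section \<open>Growth and decay of functions of finite genus\<close>

lemma cos_neg_middle: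
  assumes "pi / 2 < y" "y < 3 * pi / 2"
  shows "cos y < 0"
proof -
  have "cos (y - pi) > 0" by (rule cos_gt_zero_pi) (use assms in auto)
  thus ?thesis by (simp add: cos_diff)
qed

lemma cos_nat_pi_plus:
  "cos (real n * (pi + x)) = (-1) ^ n * cos (real n * x)"
proof -
  have "cos (real n * (pi + x)) = cos (real n * pi + real n * x)" by (simp add: algebra_simps)
  also have "\<dots> = (-1) ^ n * cos (real n * x)" by (simp add: cos_add)
  finally show ?thesis .
qed

text \<open>
  Around \<open>pi\<close>, an odd multiple of the angle has cosine near \<open>-1\<close> and an even one has cosine near 1, which
  is just what is needed. The condition on \<open>p + 1\<close> determines the length.
\<close>

lemma cos_signs_near_pi_odd:
  assumes "odd p" and "pi - pi / (2 * (real p + 1)) < \<phi>" and "\<phi> < pi + pi / (2 * (real p + 1))"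
  shows "cos (real (p + 1) * \<phi>) \<ge> 0 \<and> cos (real p * \<phi>) < 0"
proof -
  define x where "x = \<phi> - pi"
  have x: "\<bar>x\<bar> < pi / (2 * (real p + 1))" using assms by (auto simp: x_def abs_less_iff)
  have "(real p + 1) * \<bar>x\<bar> < (real p + 1) * (pi / (2 * (real p + 1)))"
    using x by (intro mult_strict_left_mono) auto
  also have "\<dots> = pi / 2" by (simp add: field_simps)
  finally have l: "(real p + 1) * \<bar>x\<bar> < pi / 2" .
  have l2: "real p * \<bar>x\<bar> < pi / 2" using l by (simp add: algebra_simps)
  have "\<bar>real (p + 1) * x\<bar> < pi / 2" "\<bar>real p * x\<bar> < pi / 2"
    using l l2 by (simp_all add: abs_mult add.commute)
  hence "cos (real (p + 1) * x) > 0" "cos (real p * x) > 0"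
    by (intro cos_gt_zero_pi; simp only: abs_less_iff; linarith)+
  moreover have "\<phi> = pi + x" by (simp add: x_def)
  ultimately show ?thesis using cos_nat_pi_plus[of "p + 1" x] cos_nat_pi_plus[of p x] assms(1) by auto
qed

text \<open>
  For even \<open>p\<close> both signs are wrong at \<open>pi\<close>, and one has to turn away from it until both cosines have
  changed their sign. This costs part of the length and explains why the two parities have different
  bounds on the opening.
\<close>

lemma cos_signs_near_pi_even:
  assumes "even p" "p \<ge> 1" and "pi - 3 * pi / (2 * (real p + 1)) < \<phi>" and "\<phi> < pi - pi / (2 * real p)"
  shows "cos (real (p + 1) * \<phi>) \<ge> 0 \<and> cos (real p * \<phi>) < 0"
proof -
  define x where "x = pi - \<phi>"
  have x: "pi / (2 * real p) < x" "x < 3 * pi / (2 * (real p + 1))" using assms by (auto simp: x_def)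
  have px: "pi / 2 < real p * x" using x(1) assms(2) by (simp add: field_simps)
  have p1x: "(real p + 1) * x < 3 * pi / 2" using x(2) assms(2) by (simp add: field_simps)
  have "pi / (2 * real p) > 0" using assms(2) by simp
  hence x0: "x > 0" using x(1) by linarith
  have "cos (real p * x) < 0" by (rule cos_neg_middle) (use px p1x x0 in \<open>auto simp: algebra_simps\<close>)
  moreover have "cos (real (p + 1) * x) < 0" by (rule cos_neg_middle) (use px p1x x0 in \<open>auto simp: algebra_simps\<close>)
  moreover have "\<phi> = pi + - x" by (simp add: x_def)
  moreover have "cos (real n * - x) = cos (real n * x)" for n by simp
  ultimately show ?thesis using cos_nat_pi_plus[of "p + 1" "-x"] cos_nat_pi_plus[of p "-x"] assms(1)
    by (auto simp del: mult_minus_right)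
qed

lemma norm_poly_le:
  assumes "degree Q \<le> p" "norm (z::complex) \<ge> 1"
  shows "norm (poly Q z) \<le> (\<Sum>i\<le>degree Q. norm (coeff Q i)) * norm z ^ p"
proof -
  have "norm (poly Q z) \<le> (\<Sum>i\<le>degree Q. norm (coeff Q i) * norm z ^ i)"
    unfolding poly_altdef by (intro order_trans[OF norm_sum] sum_mono) (simp add: norm_mult norm_power)
  also have "\<dots> \<le> (\<Sum>i\<le>degree Q. norm (coeff Q i) * norm z ^ p)"
    using assms by (intro sum_mono mult_left_mono power_increasing) auto
  finally show ?thesis by (simp add: sum_distrib_right)
qed

text \<open>
  In the chosen sector the argument of the leading term stays within \<open>pi / 3\<close> of \<open>pi\<close>, so that its real
  part is at most \<open>-1/2\<close> of its modulus.
\<close>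

lemma exp_poly_decay_in_sector:
  fixes Q :: "complex poly"
  assumes p: "degree Q = p" "p \<ge> 1"
  obtains \<psi> \<alpha> c S where "\<alpha> > 0" "c > 0" "S \<ge> 0"
    "\<And>r \<theta>. r \<ge> 1 \<Longrightarrow> \<psi> \<le> \<theta> \<Longrightarrow> \<theta> \<le> \<psi> + \<alpha> \<Longrightarrow>
       Re (poly Q (of_real r * cis \<theta>)) \<le> - c * r ^ p + S * r ^ (p - 1)"
proof -
  define b where "b = lead_coeff Q"
  have b: "b \<noteq> 0" using p by (auto simp: b_def)
  define \<gamma> where "\<gamma> = Arg b"
  have b_eq: "b = of_real (norm b) * cis \<gamma>" using b by (simp add: \<gamma>_def cis_conv_exp Arg_eq)
  \<comment> \<open>the rest of \<open>Q\<close> after removal of the leading term\<close>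
  define Q' where "Q' = Q - monom b p"
  have dQ': "degree Q' \<le> p - 1"
  proof (rule degree_le, intro allI impI)
    fix i assume "i > p - 1"
    thus "coeff Q' i = 0" using p by (cases "i = p") (auto simp: Q'_def b_def coeff_eq_0)
  qed
  define S where "S = (\<Sum>i\<le>degree Q'. norm (coeff Q' i))"
  have bd: "Re (poly Q (of_real r * cis \<theta>)) \<le> - (norm b / 2) * r ^ p + S * r ^ (p - 1)"
    if r: "r \<ge> 1" and th: "(2 * pi / 3 - \<gamma>) / real p \<le> \<theta>" "\<theta> \<le> (2 * pi / 3 - \<gamma>) / real p + 2 * pi / (3 * real p)" for r \<theta>
  proof -
    define z where "z = of_real r * cis \<theta>"
    have nz: "norm z = r" using r by (simp add: z_def norm_mult)
    have "poly Q z = b * z ^ p + poly Q' z" by (simp add: Q'_def poly_monom)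
    hence "Re (poly Q z) \<le> Re (b * z ^ p) + norm (poly Q' z)" using complex_Re_le_cmod by auto
    also have "norm (poly Q' z) \<le> S * r ^ (p - 1)"
      using norm_poly_le[OF dQ', of z] nz r by (simp add: S_def)
    also have "b * z ^ p = of_real (norm b * r ^ p) * cis (\<gamma> + real p * \<theta>)"
      by (subst b_eq) (simp add: z_def power_mult_distrib Complex.DeMoivre cis_mult[symmetric])
    also have "Re \<dots> = norm b * r ^ p * cos (\<gamma> + real p * \<theta>)" by simp
    also have "\<dots> \<le> norm b * r ^ p * (- (1/2))"
    proof (intro mult_left_mono)
      have "real p * \<theta> \<ge> 2 * pi / 3 - \<gamma>" using th(1) p by (simp add: field_simps)
      moreover have "real p * \<theta> \<le> real p * ((2 * pi / 3 - \<gamma>) / real p + 2 * pi / (3 * real p))"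
        using th(2) by (intro mult_left_mono) auto
      moreover have "\<dots> = 4 * pi / 3 - \<gamma>" using p by (simp add: distrib_left field_simps)
      ultimately have "\<bar>\<gamma> + real p * \<theta> - pi\<bar> \<le> pi / 3" by (simp only: abs_le_iff) linarith
      hence "cos (\<gamma> + real p * \<theta> - pi) \<ge> cos (pi / 3)"
        by (subst cos_abs_real[of "\<gamma> + real p * \<theta> - pi", symmetric], intro cos_monotone_0_pi_le) auto
      thus "cos (\<gamma> + real p * \<theta>) \<le> - (1/2)" by (simp add: cos_diff cos_60)
    qed (use r in auto)
    finally show ?thesis by (simp add: z_def)
  qed
  show thesis
    by (rule that[of "2 * pi / (3 * real p)" "norm b / 2" S "(2 * pi / 3 - \<gamma>) / real p"])
       (use p b bd in \<open>auto simp: S_def sum_nonneg\<close>)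
qed

lemma leading_term_dominates:
  fixes r :: real
  assumes "r \<ge> 1" "p \<ge> 1" "c > 0" "r \<ge> 2 * S / c" "r \<ge> 2 * C / c" "S \<ge> 0"
  shows "- c * r ^ p + S * r ^ (p - 1) + C \<le> 0"
proof -
  have rp: "r ^ p = r * r ^ (p - 1)" using assms by (cases p) auto
  have "S \<le> c / 2 * r" using assms by (simp add: pos_divide_le_eq mult.commute)
  hence "S * r ^ (p - 1) \<le> (c / 2 * r) * r ^ (p - 1)" using assms by (intro mult_right_mono) auto
  moreover have "C \<le> c / 2 * r" using assms by (simp add: pos_divide_le_eq mult.commute)
  moreover have "c / 2 * (r * 1) \<le> c / 2 * (r * r ^ (p - 1))"
    using assms by (intro mult_left_mono one_le_power) auto
  ultimately show ?thesis by (simp add: rp)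
qed

text \<open>
  The characteristic is at most a multiple of \<open>r\<close>, and the constant factor disappears after division
  of the logarithm by \<open>ln r\<close>.
\<close>

lemma exponential_type_imp_order_le_1:
  assumes bound: "\<And>z. norm z \<ge> 1 \<Longrightarrow> norm (A z) \<le> exp (c * norm z)" and contA: "continuous_on UNIV A"
  shows "growth_order A \<le> 1"
proof -
  define c1 where "c1 = max 1 c"
  have T: "nevanlinna_T r A \<le> c1 * r" if r: "r \<ge> 1" for r
  proof -
    have cont: "continuous_on {0..2*pi} (\<lambda>\<theta>. log_plus (norm (A (of_real r * cis \<theta>))))"
      by (intro continuous_intros continuous_on_compose2[OF contA]) auto
    have "integral {0..2*pi} (\<lambda>\<theta>. log_plus (norm (A (of_real r * cis \<theta>)))) \<le> integral {0..2*pi} (\<lambda>\<theta>. c1 * r)"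
    proof (intro integral_le integrable_continuous_interval cont continuous_intros)
      fix \<theta> :: real
      have "norm (A (of_real r * cis \<theta>)) \<le> exp (c * r)" using bound[of "of_real r * cis \<theta>"] r by (simp add: norm_mult)
      also have "\<dots> \<le> exp (c1 * r)" using r by (simp add: c1_def mult_right_mono)
      finally have "max 1 (norm (A (of_real r * cis \<theta>))) \<le> exp (c1 * r)" using r by (simp add: c1_def)
      hence "ln (max 1 (norm (A (of_real r * cis \<theta>)))) \<le> ln (exp (c1 * r))" by (intro ln_mono) auto
      thus "log_plus (norm (A (of_real r * cis \<theta>))) \<le> c1 * r" by (simp add: log_plus_alt)
    qed
    also have "\<dots> = 2 * pi * (c1 * r)" by simp
    finally show ?thesis by (simp add: nevanlinna_T_def field_simps)
  qed
  have "growth_order A \<le> ereal (1 + e)" if e: "e > 0" for e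
    unfolding growth_order_def
  proof (rule Limsup_bounded)
    have "eventually (\<lambda>r. r \<ge> max 2 (exp (ln c1 / e))) at_top" by (rule eventually_ge_at_top)
    thus "eventually (\<lambda>r. ereal (log_plus (nevanlinna_T r A) / ln r) \<le> ereal (1 + e)) at_top"
    proof eventually_elim
      case (elim r)
      have r: "r \<ge> 2" "ln r \<ge> ln c1 / e" using elim by (auto simp: ln_ge_iff)
      have "max 1 (nevanlinna_T r A) \<le> c1 * r"
        using T[of r] r mult_mono[of 1 c1 1 r] by (auto simp: c1_def)
      hence "log_plus (nevanlinna_T r A) \<le> ln (c1 * r)" unfolding log_plus_alt by (intro ln_mono) auto
      also have "\<dots> = ln c1 + ln r" using r by (simp add: c1_def ln_mult)
      also have "\<dots> \<le> (1 + e) * ln r" using r e by (simp add: field_simps)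
      finally have "log_plus (nevanlinna_T r A) / ln r \<le> 1 + e" using r by (simp add: pos_divide_le_eq)
      thus ?case by simp
    qed
  qed
  hence "growth_order A \<le> 1 + ereal e" if "e > 0" for e using that by (simp add: one_ereal_def)
  thus ?thesis using ereal_le_epsilon2 by blast
qed

text \<open>
  The decay has two sources: if the genus is that of the canonical product, the product decays and
  dominates \<open>exp Q\<close>; if it is the degree of \<open>Q\<close>, then \<open>exp Q\<close> decays and dominates the product. In the
  first case the definition of the genus provides the divergent sum, as its exponent is the least one
  with convergence.
\<close>

lemma genus_controls_growth_and_decay:
  fixes A :: "complex \<Rightarrow> complex"
  assumes holA: "A holomorphic_on UNIV" and order: "growth_order A = ereal \<rho>" "\<rho> > 1" and genus: "has_genus A p"
    and zeros: "\<forall>z. A z = 0 \<longrightarrow> z \<in> angular_sector \<theta>1 \<theta>2"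
    and odd: "odd p \<Longrightarrow> \<theta>2 - \<theta>1 < pi / (real p + 1)"
    and even: "even p \<Longrightarrow> \<theta>2 - \<theta>1 < (2 * real p - 1) * pi / (2 * real p * (real p + 1))"
  shows "\<exists>R>0. \<forall>z. norm z \<ge> R \<longrightarrow> norm (A z) \<le> exp (norm z ^ (p + 2))"
    and "\<exists>\<psi> \<alpha> R. \<alpha> > 0 \<and> (\<forall>r\<ge>R. \<forall>\<theta>. \<psi> \<le> \<theta> \<and> \<theta> \<le> \<psi> + \<alpha> \<longrightarrow> norm (A (of_real r * cis \<theta>)) \<le> 1)"
proof -
  obtain m :: nat and Q :: "complex poly" and I :: "nat set" and a :: "nat \<Rightarrow> complex" and q :: nat
    where a_nz: "\<forall>n\<in>I. a n \<noteq> 0"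
    and summ: "(\<lambda>n. 1 / norm (a n) ^ (q + 1)) summable_on I"
    and nsumm: "\<forall>j<q. \<not> (\<lambda>n. 1 / norm (a n) ^ (j + 1)) summable_on I"
    and A: "\<forall>z. A z = z ^ m * exp (poly Q z) * (\<Prod>n. if n \<in> I then weierstrass_factor q (z / a n) else 1)"
    and p: "p = max (degree Q) q"
    using genus unfolding has_genus_def by blast
  interpret genus_product I a q by unfold_locales (use a_nz summ in auto)
  have A_eq: "A z = z ^ m * exp (poly Q z) * (\<Prod>n. elem_factor n z)" for z
    using A by (simp add: elem_factor_def)
  define S where "S = (\<Sum>i\<le>degree Q. norm (coeff Q i))"
  have S0: "S \<ge> 0" by (simp add: S_def sum_nonneg)
  have normA: "norm (A z) = norm z ^ m * exp (Re (poly Q z)) * norm (\<Prod>n. elem_factor n z)" for z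
    unfolding A_eq by (simp add: norm_mult norm_power)
  have exp_pow: "norm z ^ m \<le> exp (real m * norm z)" for z :: complex
  proof -
    have "norm z ^ m \<le> exp (norm z) ^ m"
    proof (rule power_mono)
      show "norm z \<le> exp (norm z)" using exp_ge_add_one_self[of "norm z"] by linarith
    qed simp
    thus ?thesis by (simp add: exp_of_nat_mult)
  qed
  have ReQ: "Re (poly Q z) \<le> S * norm z ^ k" if "degree Q \<le> k" "norm z \<ge> 1" for z k
    using norm_poly_le[OF that] complex_Re_le_cmod[of "poly Q z"] unfolding S_def by linarith
  obtain C where C: "C \<ge> 0" "\<And>z. norm (\<Prod>n. elem_factor n z) \<le> exp (1 * norm z ^ (q + 1) + C)"
    using product_small_growth[of 1] by auto
  define D where "D = real m + S + 1 + C"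
  have D: "D \<ge> 1" using S0 C(1) by (simp add: D_def)
  have up: "norm (A z) \<le> exp (D * norm z ^ (p + 1))" if z: "norm z \<ge> 1" for z
  proof -
    have "norm (A z) \<le> exp (real m * norm z) * exp (S * norm z ^ p) * exp (1 * norm z ^ (q + 1) + C)"
    proof -
      have "degree Q \<le> p" using p by (metis max.cobounded1)
      hence "exp (Re (poly Q z)) \<le> exp (S * norm z ^ p)" using ReQ[of p z] z by simp
      thus ?thesis unfolding normA by (intro mult_mono exp_pow C(2)) auto
    qed
    also have "\<dots> = exp (real m * norm z ^ 1 + S * norm z ^ p + norm z ^ (q + 1) + C * norm z ^ 0)"
      by (simp add: exp_add)
    also have "\<dots> \<le> exp (real m * norm z ^ (p + 1) + S * norm z ^ (p + 1) + norm z ^ (p + 1) + C * norm z ^ (p + 1))"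
      unfolding exp_le_cancel_iff using z S0 C(1) p
      by (intro add_mono mult_left_mono power_increasing) auto
    also have "\<dots> = exp (D * norm z ^ (p + 1))" by (simp add: D_def algebra_simps)
    finally show ?thesis .
  qed
  show "\<exists>R>0. \<forall>z. norm z \<ge> R \<longrightarrow> norm (A z) \<le> exp (norm z ^ (p + 2))"
  proof (intro exI[of _ D] conjI allI impI)
    fix z :: complex assume z: "norm z \<ge> D"
    have "norm (A z) \<le> exp (D * norm z ^ (p + 1))" by (rule up) (use z D in auto)
    also have "\<dots> \<le> exp (norm z * norm z ^ (p + 1))"
      unfolding exp_le_cancel_iff using z by (intro mult_right_mono) auto
    finally show "norm (A z) \<le> exp (norm z ^ (p + 2))" by simp
  qed (use D in auto)
  have p1: "p \<ge> 1"
  proof (rule ccontr)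
    assume "\<not> p \<ge> 1"
    hence "p = 0" by simp
    hence "growth_order A \<le> 1"
      using up by (intro exponential_type_imp_order_le_1[of A D] holomorphic_on_imp_continuous_on[OF holA]) auto
    thus False using order by (simp add: one_ereal_def)
  qed
  have arg: "\<exists>\<theta>. \<theta>1 < \<theta> \<and> \<theta> < \<theta>2 \<and> is_Arg (a n) \<theta>" if "n \<in> I" for n
  proof -
    have "A (a n) = 0" unfolding A_eq product_zero[OF that] by simp
    thus ?thesis using zeros unfolding angular_sector_def by blast
  qed
  show "\<exists>\<psi> \<alpha> R. \<alpha> > 0 \<and> (\<forall>r\<ge>R. \<forall>\<theta>. \<psi> \<le> \<theta> \<and> \<theta> \<le> \<psi> + \<alpha> \<longrightarrow> norm (A (of_real r * cis \<theta>)) \<le> 1)"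
  proof (cases "q = p")
    case True
    have div: "\<not> (\<lambda>n. 1 / norm (a n) ^ q) summable_on I" using nsumm[rule_format, of "q - 1"] True p1 by simp
    obtain \<beta>1 \<beta>2 where \<beta>: "\<And>\<phi>. \<beta>1 < \<phi> \<Longrightarrow> \<phi> < \<beta>2 \<Longrightarrow> cos (real (q + 1) * \<phi>) \<ge> 0 \<and> cos (real q * \<phi>) < 0"
      and narrow: "\<theta>2 - \<theta>1 < \<beta>2 - \<beta>1"
    proof (cases "odd p")
      case odd': True
      have "pi / x = (pi + pi / (2 * x)) - (pi - pi / (2 * x))" if "x > 0" for x :: real
        using that by (simp add: field_simps)
      from this[of "real p + 1"] have "pi / (real p + 1) = (pi + pi / (2 * (real p + 1))) - (pi - pi / (2 * (real p + 1)))"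
        by simp
      thus ?thesis using that[of "pi - pi / (2 * (real p + 1))" "pi + pi / (2 * (real p + 1))"]
          cos_signs_near_pi_odd[OF odd'] odd[OF odd'] True by simp
    next
      case False
      have "(2 * x - 1) * pi / (2 * x * (x + 1)) = (pi - pi / (2 * x)) - (pi - 3 * pi / (2 * (x + 1)))"
        if "x > 0" for x :: real
        using that by (simp add: divide_simps) (simp add: algebra_simps)
      from this[of "real p"]
      have "(2 * real p - 1) * pi / (2 * real p * (real p + 1)) = (pi - pi / (2 * real p)) - (pi - 3 * pi / (2 * (real p + 1)))"
        using p1 by simp
      thus ?thesis using that[of "pi - 3 * pi / (2 * (real p + 1))" "pi - pi / (2 * real p)"]
          cos_signs_near_pi_even[OF _ p1] even False True by simp
    qed
    have q1: "q \<ge> 1" using True p1 by simp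
    have dq: "degree Q \<le> q" using p True by (metis max.cobounded1)
    obtain \<psi> \<alpha> where \<alpha>: "\<alpha> > 0" and decay: "\<And>W. \<exists>R. \<forall>r\<ge>R. \<forall>\<theta>. \<psi> \<le> \<theta> \<and> \<theta> \<le> \<psi> + \<alpha> \<longrightarrow>
           norm (\<Prod>n. elem_factor n (of_real r * cis \<theta>)) \<le> exp (- W * r ^ q)"
      using product_decay_in_sector[OF q1 div arg \<beta> narrow] by blast
    obtain R where R: "\<And>r \<theta>. r \<ge> R \<Longrightarrow> \<psi> \<le> \<theta> \<Longrightarrow> \<theta> \<le> \<psi> + \<alpha> \<Longrightarrow>
           norm (\<Prod>n. elem_factor n (of_real r * cis \<theta>)) \<le> exp (- (real m + S) * r ^ q)"
      using decay[of "real m + S"] by blast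
    show ?thesis
    proof (rule exI[of _ \<psi>], rule exI[of _ \<alpha>], rule exI[of _ "max 1 R"], intro conjI allI impI)
      fix r \<theta> assume r: "r \<ge> max 1 R" and \<theta>: "\<psi> \<le> \<theta> \<and> \<theta> \<le> \<psi> + \<alpha>"
      define z where "z = of_real r * cis \<theta>"
      have nz: "norm z = r" using r by (simp add: z_def norm_mult)
      have "norm (A z) \<le> exp (real m * r) * exp (S * r ^ q) * exp (- (real m + S) * r ^ q)"
      proof -
        have "norm z ^ m \<le> exp (real m * r)" using exp_pow[of z] nz by simp
        moreover have "exp (Re (poly Q z)) \<le> exp (S * r ^ q)" using ReQ[OF dq, of z] nz r by simp
        moreover have "norm (\<Prod>n. elem_factor n z) \<le> exp (- (real m + S) * r ^ q)"
          unfolding z_def by (rule R) (use r \<theta> in auto)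
        ultimately show ?thesis unfolding normA by (intro mult_mono) auto
      qed
      also have "\<dots> = exp (real m * r ^ 1 + S * r ^ q - (real m + S) * r ^ q)"
        by (simp add: exp_add[symmetric] algebra_simps)
      also have "\<dots> \<le> exp (real m * r ^ q + S * r ^ q - (real m + S) * r ^ q)"
        unfolding exp_le_cancel_iff using r q1 S0 by (intro diff_mono add_mono mult_left_mono power_increasing) auto
      also have "\<dots> = 1" by (simp add: algebra_simps)
      finally show "norm (A (of_real r * cis \<theta>)) \<le> 1" by (simp add: z_def)
    qed (rule \<alpha>)
  next
    case False
    hence qp: "degree Q = p" "q + 1 \<le> p" using p by auto
    obtain \<psi> \<alpha> c S' where \<alpha>: "\<alpha> > 0" and c: "c > 0" and S': "S' \<ge> 0"
      and Q: "\<And>r \<theta>. r \<ge> 1 \<Longrightarrow> \<psi> \<le> \<theta> \<Longrightarrow> \<theta> \<le> \<psi> + \<alpha> \<Longrightarrow>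
       Re (poly Q (of_real r * cis \<theta>)) \<le> - c * r ^ p + S' * r ^ (p - 1)"
      using exp_poly_decay_in_sector[OF qp(1) p1] by metis
    obtain C1 where C1: "\<And>z. norm (\<Prod>n. elem_factor n z) \<le> exp (c/4 * norm z ^ (q + 1) + C1)"
      using product_small_growth[of "c/4"] c by auto
    \<comment> \<open>\<open>\<eta>\<close> is so small that \<open>r^m\<close> takes up at most another quarter of the exponent \<open>- c r^p\<close>\<close>
    define \<eta> where "\<eta> = c / (4 * (real m + 1))"
    have \<eta>: "\<eta> > 0" "real m * \<eta> \<le> c / 4" using c by (auto simp: \<eta>_def field_simps)
    define C2 where "C2 = real m * (\<eta> - ln \<eta>)"
    have pw: "r ^ m \<le> exp (c/4 * r + C2)" if "r \<ge> 0" for r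
    proof -
      have "r ^ m \<le> exp (\<eta> * r + (\<eta> - ln \<eta>)) ^ m"
        using one_plus_le_exp[OF that \<eta>(1)] that by (intro power_mono) auto
      also have "\<dots> = exp (real m * \<eta> * r + C2)" by (simp add: C2_def exp_of_nat_mult[symmetric] algebra_simps)
      also have "\<dots> \<le> exp (c/4 * r + C2)" using mult_right_mono[OF \<eta>(2) that] by simp
      finally show ?thesis .
    qed
    define R where "R = max 1 (max (2 * S' / (c/2)) (2 * (C1 + C2) / (c/2)))"
    show ?thesis
    proof (rule exI[of _ \<psi>], rule exI[of _ \<alpha>], rule exI[of _ R], intro conjI allI impI)
      fix r \<theta> assume r: "r \<ge> R" and \<theta>: "\<psi> \<le> \<theta> \<and> \<theta> \<le> \<psi> + \<alpha>"
      have r1: "r \<ge> 1" using r by (simp add: R_def)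
      define z where "z = of_real r * cis \<theta>"
      have nz: "norm z = r" using r1 by (simp add: z_def norm_mult)
      have "norm (A z) \<le> exp (c/4 * r + C2) * exp (- c * r ^ p + S' * r ^ (p - 1)) * exp (c/4 * r ^ (q + 1) + C1)"
      proof -
        have "norm z ^ m \<le> exp (c/4 * r + C2)" using pw[of r] r1 nz by simp
        moreover have "exp (Re (poly Q z)) \<le> exp (- c * r ^ p + S' * r ^ (p - 1))"
          unfolding exp_le_cancel_iff z_def by (rule Q) (use r1 \<theta> in auto)
        moreover have "norm (\<Prod>n. elem_factor n z) \<le> exp (c/4 * r ^ (q + 1) + C1)" using C1[of z] nz by simp
        ultimately show ?thesis unfolding normA by (intro mult_mono) auto
      qed
      also have "\<dots> = exp (c/4 * r ^ 1 + c/4 * r ^ (q + 1) + (- c * r ^ p + S' * r ^ (p - 1) + (C1 + C2)))"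
        by (simp add: exp_add[symmetric] algebra_simps)
      also have "\<dots> \<le> exp (c/4 * r ^ p + c/4 * r ^ p + (- c * r ^ p + S' * r ^ (p - 1) + (C1 + C2)))"
        unfolding exp_le_cancel_iff using r1 c qp p1 by (intro add_mono mult_left_mono power_increasing order_refl) auto
      also have "\<dots> = exp (- (c/2) * r ^ p + S' * r ^ (p - 1) + (C1 + C2))" by (simp add: algebra_simps)
      also have "\<dots> \<le> 1"
        using leading_term_dominates[OF r1 p1, of "c/2" S' "C1 + C2"] c S' r by (simp add: R_def)
      finally show "norm (A (of_real r * cis \<theta>)) \<le> 1" by (simp add: z_def)
    qed (rule \<alpha>)
  qed
qed

section \<open>Trigonometric sums with few terms\<close>

lemma power_le_exp_mult_fact: "real m ^ m \<le> exp (real m) * fact m"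
proof -
  have "(\<Sum>n\<in>{m}. inverse (fact n) *\<^sub>R real m ^ n) \<le> (\<Sum>n. inverse (fact n) *\<^sub>R real m ^ n)"
    using summable_exp_generic[of "real m"] by (intro sum_le_suminf) auto
  hence "real m ^ m / fact m \<le> exp (real m)" by (simp add: exp_def field_simps)
  thus ?thesis by (simp add: field_simps)
qed

text \<open>
  The product of the distances is \<open>k! (m - 1 - k)!\<close>, which is at least \<open>(m - 1)! / 2^(m-1)\<close> and hence
  equal to \<open>m^(m-1)\<close> up to a factor \<open>C^m\<close>. It is essential that nothing more is lost: the trivial
  lower bound 1 for each distance would cost \<open>m^m\<close>.
\<close>

lemma prod_distances_lower_bound:
  assumes "k < m" and \<beta>: "0 < \<beta>" "\<beta> \<le> 1"
  shows "(\<Prod>i\<in>{..<m} - {k}. \<beta> * \<bar>real k - real i\<bar> / real m) \<ge> (\<beta> / 6) ^ m"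
proof -
  have m: "m > 0" using assms by simp
  have set: "{..<m} - {k} = {0..<k} \<union> {k+1..<m}" "{0..<k} \<inter> {k+1..<m} = {}"
    using \<open>k < m\<close> by auto
  have card: "card ({..<m} - {k}) = m - 1" using \<open>k < m\<close> by simp
  have "(\<Prod>i\<in>{0..<k}. \<bar>real k - real i\<bar>) = fact k"
    by (simp add: fact_prod_rev of_nat_diff flip: of_nat_prod)
       (auto intro!: prod.cong simp: of_nat_diff)
  moreover have "(\<Prod>i\<in>{k+1..<m}. \<bar>real k - real i\<bar>) = fact (m - 1 - k)"
  proof -
    have "(\<Prod>i\<in>{k+1..<m}. \<bar>real k - real i\<bar>) = (\<Prod>j\<in>{1..m-1-k}. real j)"
      by (rule prod.reindex_bij_witness[of _ "\<lambda>j. j + k" "\<lambda>i. i - k"]) (use \<open>k < m\<close> in auto)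
    thus ?thesis by (simp add: fact_prod)
  qed
  ultimately have dist: "(\<Prod>i\<in>{..<m} - {k}. \<bar>real k - real i\<bar>) = fact k * fact (m - 1 - k)"
    unfolding set(1) by (subst prod.union_disjoint) (use set(2) in auto)
  have "fact (m - 1) = real ((m - 1) choose k) * (fact k * fact (m - 1 - k))"
  proof -
    have "fact k * fact (m - 1 - k) * ((m - 1) choose k) = (fact (m - 1) :: nat)"
      by (rule binomial_fact_lemma) (use \<open>k < m\<close> in auto)
    hence "real (fact k * fact (m - 1 - k) * ((m - 1) choose k)) = real (fact (m - 1))" by (simp only:)
    thus ?thesis by (simp add: mult_ac)
  qed
  also have "\<dots> \<le> 2 ^ (m - 1) * (fact k * fact (m - 1 - k))"
  proof (intro mult_right_mono)
    have "real ((m - 1) choose k) \<le> real (2 ^ (m - 1))"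
      by (intro of_nat_mono binomial_le_pow2)
    thus "real ((m - 1) choose k) \<le> 2 ^ (m - 1)" by simp
  qed auto
  finally have b1: "fact (m - 1) \<le> 2 ^ (m - 1) * (fact k * fact (m - 1 - k) :: real)" .
  have "real m ^ (m - 1) * real m \<le> 3 ^ m * (fact (m - 1) * real m)"
  proof -
    have "real m ^ (m - 1) * real m = real m ^ m" using m by (simp flip: power_Suc2)
    also have "\<dots> \<le> exp (real m) * fact m" by (rule power_le_exp_mult_fact)
    also have "exp (real m) = exp 1 ^ m" by (simp flip: exp_of_nat_mult)
    also have "exp 1 ^ m * fact m \<le> 3 ^ m * (fact m :: real)"
      using exp_le by (intro mult_right_mono power_mono) auto
    also have "(fact m :: real) = fact (m - 1) * real m"
      using m by (simp add: fact_reduce)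
    finally show ?thesis .
  qed
  hence "real m ^ (m - 1) \<le> 3 ^ m * fact (m - 1)" using m by (simp add: mult.assoc[symmetric])
  also have "\<dots> \<le> 3 ^ m * (2 ^ m * (fact k * fact (m - 1 - k)))"
    using b1 power_increasing[of "m - 1" m "2::real"]
    by (intro mult_left_mono order_trans[OF b1] mult_right_mono) auto
  also have "\<dots> = 6 ^ m * (fact k * fact (m - 1 - k))" by (simp flip: power_mult_distrib)
  finally have b2: "1 / 6 ^ m \<le> (fact k * fact (m - 1 - k)) / real m ^ (m - 1)"
    using m by (simp add: field_simps)
  have "(\<beta> / 6) ^ m = \<beta> ^ m * (1 / 6 ^ m)" by (simp add: power_divide)
  also have "\<dots> \<le> \<beta> ^ (m - 1) * ((fact k * fact (m - 1 - k)) / real m ^ (m - 1))"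
    using b2 \<beta> power_decreasing[of "m - 1" m \<beta>] by (intro mult_mono) auto
  also have "\<dots> = (\<Prod>i\<in>{..<m} - {k}. \<beta> * \<bar>real k - real i\<bar> / real m)"
    using dist card by (simp add: prod_dividef prod.distrib)
  finally show ?thesis .
qed

lemma strict_mono_diff_ge:
  fixes l :: "nat \<Rightarrow> nat"
  assumes "strict_mono l"
  shows "\<bar>real (l k) - real (l i)\<bar> \<ge> \<bar>real k - real i\<bar>"
proof -
  have aux: "l i + (k - i) \<le> l k" if "i \<le> k" for i k
    using that
  proof (induction k rule: dec_induct)
    case (step n)
    have "l n < l (Suc n)" using assms by (simp add: strict_mono_def)
    thus ?case using step by auto
  qed auto
  show ?thesis using aux[of i k] aux[of k i] by (cases "i \<le> k") auto
qed

lemma cis_diff_lower_bound: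
  fixes x y :: real
  assumes "\<bar>x - y\<bar> \<le> 1/2"
  shows "norm (cis x - cis y) \<ge> \<bar>x - y\<bar> / 2"
proof -
  have "norm (cis x - cis y) = norm (cis y * (exp (\<i> * of_real (x - y)) - 1))"
    by (simp add: cis_conv_exp algebra_simps flip: exp_add)
  also have "\<dots> = norm (exp (\<i> * of_real (x - y)) - 1)" by (simp add: norm_mult)
  also have "\<dots> \<ge> 1 / 2 * norm (\<i> * of_real (x - y))"
    by (rule norm_exp_bounds(1)) (use assms in \<open>simp add: norm_mult flip: of_real_diff\<close>)
  finally show ?thesis by (simp add: norm_mult flip: of_real_diff)
qed

text \<open>
  The difference operator \<open>P \<mapsto> P(\<theta> + h\<^sub>i) - cis (l\<^sub>i h\<^sub>i) P(\<theta>)\<close> annihilates the frequency \<open>l\<^sub>i\<close>, multiplies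
  every other coefficient by \<open>cis (l\<^sub>j h\<^sub>i) - cis (l\<^sub>i h\<^sub>i)\<close>, and at most doubles the supremum. Applying it for
  all \<open>i \<noteq> k\<close> isolates the coefficient \<open>c k\<close>. The shifts \<open>h\<^sub>i\<close> have a total length of at most \<open>\<alpha>\<close>, so
  the arc is never left, and they are as large as this permits without the multiplier wrapping around the
  circle; since integer frequencies satisfy \<open>\<bar>l\<^sub>k - l\<^sub>i\<bar> \<ge> \<bar>k - i\<bar>\<close>, the multipliers are bounded
  below by \<open>\<alpha> \<bar>k - i\<bar> / (4 m)\<close>.
\<close>

lemma Turan_coefficient_bound:
  fixes l :: "nat \<Rightarrow> nat" and c :: "nat \<Rightarrow> complex"
  assumes l: "strict_mono l" and "k < m" and \<alpha>: "0 < \<alpha>" "\<alpha> \<le> 1"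
    and X: "\<And>\<theta>. \<psi> \<le> \<theta> \<Longrightarrow> \<theta> \<le> \<psi> + \<alpha> \<Longrightarrow> norm (\<Sum>j<m. c j * cis (real (l j) * \<theta>)) \<le> X"
  shows "norm (c k) \<le> (48 / \<alpha>) ^ m * X"
proof -
  have m: "m > 0" using \<open>k < m\<close> by simp
  define d where "d = (\<lambda>i. \<bar>real (l k) - real (l i)\<bar>)"
  define h where "h = (\<lambda>i. min (\<alpha> / real m) (1 / (2 * d i)))"
  have d1: "d i \<ge> 1" if "i \<noteq> k" for i
  proof -
    have "\<bar>real k - real i\<bar> \<ge> 1" using that by linarith
    thus ?thesis using strict_mono_diff_ge[OF l, of k i] unfolding d_def by linarith
  qed
  have h0: "h i \<ge> 0" for i using \<alpha> by (auto simp: h_def d_def)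
  define P where "P = (\<lambda>J \<theta>. \<Sum>j<m. c j * (\<Prod>i\<in>J. cis (real (l j) * h i) - cis (real (l i) * h i)) * cis (real (l j) * \<theta>))"
  have bound: "norm (P J \<theta>) \<le> 2 ^ card J * X"
    if "finite J" "\<psi> \<le> \<theta>" "\<theta> + sum h J \<le> \<psi> + \<alpha>" for J \<theta>
    using that
  proof (induction J arbitrary: \<theta> rule: finite_induct)
    case empty
    thus ?case using X[of \<theta>] by (simp add: P_def)
  next
    case (insert i J)
    have "P (insert i J) \<theta> = P J (\<theta> + h i) - cis (real (l i) * h i) * P J \<theta>"
      using insert(1,2) unfolding P_def sum_distrib_left sum_subtractf[symmetric]
      by (intro sum.cong refl) (simp add: algebra_simps cis_mult[symmetric] flip: cis_mult)
    also have "norm \<dots> \<le> norm (P J (\<theta> + h i)) + norm (P J \<theta>)"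
      by (rule order_trans[OF norm_triangle_ineq4]) (simp add: norm_mult)
    also have "\<dots> \<le> 2 ^ card J * X + 2 ^ card J * X"
    proof (rule add_mono)
      show "norm (P J (\<theta> + h i)) \<le> 2 ^ card J * X"
        by (rule insert.IH) (use insert(1,2,4,5) h0[of i] in auto)
      show "norm (P J \<theta>) \<le> 2 ^ card J * X"
        by (rule insert.IH) (use insert(1,2,4,5) h0[of i] in auto)
    qed
    finally show ?case using insert(1,2) by (simp add: mult_ac)
  qed
  define J where "J = {..<m} - {k}"
  have J: "finite J" "card J = m - 1" using \<open>k < m\<close> by (auto simp: J_def)
  have "sum h J \<le> (\<Sum>i\<in>J. \<alpha> / real m)" by (intro sum_mono) (simp add: h_def)
  also have "\<dots> \<le> \<alpha>" using J \<alpha> m by (simp add: field_simps)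
  finally have Pb: "norm (P J \<psi>) \<le> 2 ^ (m - 1) * X" using bound[OF J(1), of \<psi>] J(2) by simp
  have "P J \<psi> = (\<Sum>j\<in>{k}. c j * (\<Prod>i\<in>J. cis (real (l j) * h i) - cis (real (l i) * h i)) * cis (real (l j) * \<psi>))"
    unfolding P_def
  proof (rule sum.mono_neutral_right)
    show "\<forall>j\<in>{..<m} - {k}. c j * (\<Prod>i\<in>J. cis (real (l j) * h i) - cis (real (l i) * h i)) * cis (real (l j) * \<psi>) = 0"
      using J(1) by (auto simp: J_def intro!: prod_zero)
  qed (use \<open>k < m\<close> in auto)
  hence "norm (P J \<psi>) = norm (c k) * (\<Prod>i\<in>J. norm (cis (real (l k) * h i) - cis (real (l i) * h i)))"
    by (simp add: norm_mult prod_norm)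
  also have "\<dots> \<ge> norm (c k) * (\<Prod>i\<in>J. (\<alpha> / 4) * \<bar>real k - real i\<bar> / real m)"
  proof (intro mult_left_mono prod_mono conjI)
    fix i assume "i \<in> J"
    hence i: "i < m" "i \<noteq> k" by (auto simp: J_def)
    have dk: "\<bar>real k - real i\<bar> \<le> d i" using strict_mono_diff_ge[OF l, of k i] by (simp add: d_def)
    have eq: "\<bar>real (l k) * h i - real (l i) * h i\<bar> = d i * h i"
      using h0[of i] by (simp add: d_def abs_mult flip: left_diff_distrib)
    have "d i * h i \<le> d i * (1 / (2 * d i))" using d1[OF i(2)] by (intro mult_left_mono) (auto simp: h_def)
    hence le: "d i * h i \<le> 1/2" using d1[OF i(2)] by simp
    have "(\<alpha> / 4) * \<bar>real k - real i\<bar> / real m \<le> d i * h i / 2"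
    proof (cases "\<alpha> / real m \<le> 1 / (2 * d i)")
      case True
      hence "d i * h i / 2 = d i * \<alpha> / real m / 2" by (simp add: h_def)
      moreover have "\<bar>real k - real i\<bar> * \<alpha> / real m \<le> d i * \<alpha> / real m"
        using dk \<alpha> by (intro divide_right_mono mult_right_mono) auto
      moreover have "0 \<le> \<bar>real k - real i\<bar> * \<alpha> / real m" using \<alpha> by simp
      ultimately show ?thesis by (simp add: mult.commute) 
    next
      case False
      hence "d i * h i / 2 = 1 / 4" using d1[OF i(2)] by (simp add: h_def)
      moreover have "\<alpha> * \<bar>real k - real i\<bar> / real m \<le> 1"
      proof -
        have "\<bar>real k - real i\<bar> \<le> real m" using i(1) \<open>k < m\<close> by linarith
        hence "\<alpha> * \<bar>real k - real i\<bar> \<le> 1 * real m" using \<alpha> by (intro mult_mono) auto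
        thus ?thesis using m by simp
      qed
      ultimately show ?thesis by simp
    qed
    also have "\<dots> \<le> norm (cis (real (l k) * h i) - cis (real (l i) * h i))"
      using cis_diff_lower_bound[of "real (l k) * h i" "real (l i) * h i"] le eq by simp
    finally show "(\<alpha> / 4) * \<bar>real k - real i\<bar> / real m \<le> norm (cis (real (l k) * h i) - cis (real (l i) * h i))" .
  qed (use \<alpha> in auto)
  finally have "norm (c k) * (\<Prod>i\<in>J. (\<alpha> / 4) * \<bar>real k - real i\<bar> / real m) \<le> norm (P J \<psi>)" .
  moreover have "(\<alpha> / 4 / 6) ^ m \<le> (\<Prod>i\<in>J. (\<alpha> / 4) * \<bar>real k - real i\<bar> / real m)"
    unfolding J_def by (rule prod_distances_lower_bound[OF \<open>k < m\<close>]) (use \<alpha> in auto)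
  ultimately have "norm (c k) * (\<alpha> / 4 / 6) ^ m \<le> norm (P J \<psi>)"
    using mult_left_mono[OF _ norm_ge_zero] order_trans by blast
  also have "\<dots> \<le> 2 ^ m * X"
  proof -
    have "X \<ge> 0" by (rule order_trans[OF norm_ge_zero X[of \<psi>]]) (use \<alpha> in auto)
    hence "2 ^ (m - 1) * X \<le> 2 ^ m * X" by (intro mult_right_mono power_increasing) auto
    thus ?thesis using Pb by simp
  qed
  finally have "norm (c k) \<le> 2 ^ m * X / (\<alpha> / 24) ^ m" using \<alpha> by (simp add: pos_le_divide_eq)
  also have "\<dots> = (2 / (\<alpha> / 24)) ^ m * X" by (simp only: power_divide[of 2] times_divide_eq_left)
  also have "2 / (\<alpha> / 24) = 48 / \<alpha>" by simp
  finally show ?thesis .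
qed

section \<open>Power series with Fabry gaps\<close>

text \<open>
  Cauchy's inequality for a power series that is given by its nonzero terms only.
\<close>

lemma power_series_coefficient_bound:
  fixes l :: "nat \<Rightarrow> nat" and a :: "nat \<Rightarrow> complex"
  assumes hol: "B holomorphic_on UNIV"
    and l: "strict_mono l" and B: "\<And>z. (\<lambda>n. a n * z ^ l n) sums B z" and r: "r > 0"
    and S: "\<And>z. norm z = r \<Longrightarrow> norm (B z) \<le> S"
  shows "norm (a n) * r ^ l n \<le> S"
proof -
  define b where "b = (\<lambda>k. if k \<in> range l then a (inv l k) else 0)"
  have inj: "inj l" using l by (rule strict_mono_imp_inj_on)
  have bl: "b (l n) = a n" for n by (simp add: b_def inj)
  have b: "(\<lambda>k. b k * z ^ k) sums B z" for z
    by (subst sums_mono_reindex[OF l, symmetric]) (use B bl in \<open>auto simp: b_def\<close>)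
  have rad: "fps_conv_radius (Abs_fps b) = \<infinity>"
    unfolding fps_conv_radius_def
    by (rule conv_radius_inftyI'') (use b in \<open>auto simp: sums_iff\<close>)
  have "B has_fps_expansion Abs_fps b"
    unfolding has_fps_expansion_def using rad b by (auto simp: eval_fps_def sums_iff)
  hence co: "(deriv ^^ l n) B 0 / fact (l n) = a n"
    using fps_nth_fps_expansion[of B "Abs_fps b" "l n"] by (simp add: bl)
  have "norm ((deriv ^^ l n) B 0) \<le> fact (l n) * S / r ^ l n"
    by (rule Cauchy_inequality[OF holomorphic_on_subset[OF hol]
          holomorphic_on_imp_continuous_on[OF holomorphic_on_subset[OF hol]]])
       (use r S in auto)
  hence "norm (a n * fact (l n)) \<le> fact (l n) * S / r ^ l n" unfolding co[symmetric] by simp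
  thus ?thesis using r by (simp add: norm_mult field_simps)
qed

text \<open>
  If \<open>L\<close> grew by the factor \<open>2^(K+1)\<close> at every step, it would exceed \<open>2^(k K)\<close> eventually. With \<open>L k\<close>
  the logarithm of the maximum modulus at radius \<open>2^k\<close>, this provides radii \<open>r\<close> where the values at
  \<open>r\<close> and \<open>2 r\<close> are comparable.
\<close>

lemma frequently_regular_growth:
  fixes L :: "nat \<Rightarrow> real"
  assumes pos: "\<And>k. k \<ge> k0 \<Longrightarrow> L k \<ge> 1" and up: "\<And>k. k \<ge> k0 \<Longrightarrow> L k \<le> 2 ^ (k * K)"
  shows "\<exists>k\<ge>k0. L (Suc k) \<le> 2 ^ (K + 1) * L k"
proof (rule ccontr)
  assume "\<not> ?thesis"
  hence step: "L (Suc k) \<ge> 2 ^ (K + 1) * L k" if "k \<ge> k0" for k using that by force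
  have "L (k0 + i) \<ge> 2 ^ ((K + 1) * i)" for i
  proof (induction i)
    case 0 thus ?case using pos by simp
  next
    case (Suc i)
    have "(2::real) ^ ((K + 1) * Suc i) = 2 ^ (K + 1) * 2 ^ ((K + 1) * i)"
      by (simp only: mult_Suc_right power_add)
    also have "\<dots> \<le> (2::real) ^ (K + 1) * L (k0 + i)" using Suc by (intro mult_left_mono) auto
    also have "\<dots> \<le> L (k0 + Suc i)" using step[of "k0 + i"] by simp
    finally show ?case by simp
  qed
  from this[of "k0 * K + 1"] up[of "k0 + (k0 * K + 1)"]
  have "(2::real) ^ ((K + 1) * (k0 * K + 1)) \<le> 2 ^ ((k0 + (k0 * K + 1)) * K)" by linarith
  hence "(K + 1) * (k0 * K + 1) \<le> (k0 + (k0 * K + 1)) * K" by (subst (asm) power_increasing_iff) auto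
  thus False by (simp add: algebra_simps)
qed

text \<open>
  A bound for the terms at radius \<open>2 r\<close> makes the terms at radius \<open>r\<close> decay geometrically in the exponent.
\<close>

lemma gap_tail_bound:
  fixes l :: "nat \<Rightarrow> nat" and a :: "nat \<Rightarrow> complex"
  assumes l: "strict_mono l" and B: "(\<lambda>n. a n * z ^ l n) sums b" and r: "norm z = r" "r > 0"
    and co: "\<And>n. norm (a n) * (2 * r) ^ l n \<le> S"
  shows "norm (b - (\<Sum>n<m. a n * z ^ l n)) \<le> 2 * S / 2 ^ l m"
proof -
  have S0: "S \<ge> 0" using co[of 0] r by (meson mult_nonneg_nonneg norm_ge_zero order_trans zero_le_power less_imp_le mult_pos_pos zero_less_numeral)
  have t: "norm (a (n + m) * z ^ l (n + m)) \<le> S / 2 ^ l m * (1/2) ^ n" for n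
  proof -
    have "norm (a (n + m) * z ^ l (n + m)) * 2 ^ l (n + m) \<le> S"
      using co[of "n + m"] r by (simp add: norm_mult norm_power power_mult_distrib mult_ac)
    hence "norm (a (n + m) * z ^ l (n + m)) \<le> S / 2 ^ l (n + m)" by (simp add: pos_le_divide_eq)
    also have "\<dots> \<le> S / 2 ^ (l m + n)"
    proof (intro divide_left_mono power_increasing)
      show "l m + n \<le> l (n + m)"
        using strict_mono_diff_ge[OF l, of "n + m" m] strict_mono_mono[OF l] monoD[of l m "n + m"] by simp
    qed (use S0 in auto)
    finally show ?thesis by (simp add: power_add power_divide)
  qed
  have s1: "(\<lambda>n. a (n + m) * z ^ l (n + m)) sums (b - (\<Sum>n<m. a n * z ^ l n))"
    by (rule sums_split_initial_segment[OF B])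
  have s2: "(\<lambda>n. S / 2 ^ l m * (1/2) ^ n) sums (S / 2 ^ l m * 2)"
    using sums_mult[OF geometric_sums[of "1/2::real"], of "S / 2 ^ l m"] by simp
  have "norm (\<Sum>n. a (n + m) * z ^ l (n + m)) \<le> (\<Sum>n. S / 2 ^ l m * (1/2) ^ n)"
    by (rule norm_suminf_le) (use s2 t in \<open>auto simp: sums_iff\<close>)
  thus ?thesis using s1 s2 by (simp add: sums_iff mult_ac)
qed

text \<open>
  On a circle of regular growth the tail beyond the frequency \<open>N = O(L)\<close> is at most 1, where \<open>L\<close> is the
  logarithm of the maximum modulus, and only \<open>m \<le> \<epsilon> N + O(1)\<close> terms precede it. The Turan-type
  inequality carries the polynomial bound from the arc over to the whole circle at the expense of a
  factor \<open>C^m\<close>. With \<open>\<epsilon>\<close> small enough this yields \<open>L \<le> L / 4 + M ln r + O(1)\<close>, while \<open>L / ln r\<close> is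
  unbounded because infinitely many coefficients are nonzero.
\<close>

lemma fabry_gap_not_polynomially_bounded_in_sector:
  assumes holB: "B holomorphic_on UNIV" and gap: "fabry_gap B" and \<alpha>: "\<alpha> > 0" and "R0 > 0"
    and growth: "\<And>z. norm z \<ge> R0 \<Longrightarrow> norm (B z) \<le> exp (norm z ^ K)"
    and sector: "\<And>r \<theta>. r \<ge> R0 \<Longrightarrow> \<psi> \<le> \<theta> \<Longrightarrow> \<theta> \<le> \<psi> + \<alpha> \<Longrightarrow> norm (B (of_real r * cis \<theta>)) \<le> r ^ M"
  shows False
proof -
  obtain l :: "nat \<Rightarrow> nat" and a :: "nat \<Rightarrow> complex" where l: "strict_mono l" and a0: "\<And>n. a n \<noteq> 0"
    and B: "\<And>z. (\<lambda>n. a n * z ^ l n) sums B z"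
    and dens: "filterlim (\<lambda>n. real (l n) / real n) at_top sequentially"
    using gap unfolding fabry_gap_def by blast
  define \<alpha>' where "\<alpha>' = min \<alpha> 1"
  have \<alpha>': "0 < \<alpha>'" "\<alpha>' \<le> 1" "\<alpha>' \<le> \<alpha>" using \<alpha> by (auto simp: \<alpha>'_def)
  define C where "C = 48 / \<alpha>'"
  have C: "C \<ge> 48" using \<alpha>' by (simp add: C_def pos_le_divide_eq)
  have hol: "continuous_on X B" for X
    using holB holomorphic_on_imp_continuous_on holomorphic_on_subset by blast
  have "\<exists>w. norm w = r \<and> (\<forall>z. norm z = r \<longrightarrow> norm (B z) \<le> norm (B w))" if "r > 0" for r
  proof -
    have "\<exists>w\<in>sphere 0 r. \<forall>z\<in>sphere 0 r. norm (B z) \<le> norm (B w)"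
      by (rule continuous_attains_sup) (use that in \<open>auto intro!: continuous_intros hol\<close>)
    thus ?thesis by auto
  qed
  then obtain w where w: "\<And>r. r > 0 \<Longrightarrow> norm (w r) = r"
    "\<And>r z. r > 0 \<Longrightarrow> norm z = r \<Longrightarrow> norm (B z) \<le> norm (B (w r))" by metis
  define Mx where "Mx = (\<lambda>r. norm (B (w r)))"
  define L where "L = (\<lambda>r. ln (Mx r))"
  have coeff: "norm (a n) * r ^ l n \<le> Mx r" if "r > 0" for n r
    by (rule power_series_coefficient_bound[OF holB l B that]) (use w that in \<open>auto simp: Mx_def\<close>)
  have Mxpos: "Mx r > 0" if "r > 0" for r
    using coeff[OF that, of 0] a0[of 0] that by (meson less_le_trans mult_pos_pos zero_less_norm_iff zero_less_power)
  have Lup: "L r \<le> r ^ K" if "r \<ge> R0" for r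
  proof -
    have "Mx r \<le> exp (r ^ K)" using growth[of "w r"] w(1)[of r] that \<open>R0 > 0\<close> by (simp add: Mx_def)
    thus ?thesis unfolding L_def using Mxpos[of r] that \<open>R0 > 0\<close> ln_mono[of "Mx r" "exp (r ^ K)"] by simp
  qed
  have Llow: "\<exists>r0. \<forall>r\<ge>r0. L r \<ge> real D * ln r" for D :: nat
  proof -
    have lD: "l (Suc D) \<ge> Suc D" by (rule strict_mono_imp_increasing[OF l])
    show ?thesis
    proof (intro exI[of _ "max 1 (1 / norm (a (Suc D)))"] allI impI)
      fix r assume r: "r \<ge> max 1 (1 / norm (a (Suc D)))"
      have "1 \<le> norm (a (Suc D)) * r" using r a0[of "Suc D"] by (simp add: field_simps)
      hence "1 * r ^ D \<le> (norm (a (Suc D)) * r) * r ^ D" using r by (intro mult_right_mono) auto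
      also have "\<dots> = norm (a (Suc D)) * r ^ Suc D" by simp
      also have "\<dots> \<le> norm (a (Suc D)) * r ^ l (Suc D)"
        using r lD by (intro mult_left_mono power_increasing) auto
      also have "\<dots> \<le> Mx r" using r by (intro coeff) auto
      finally have "ln (r ^ D) \<le> L r" unfolding L_def using r by (intro ln_mono) auto
      thus "L r \<ge> real D * ln r" using r by (simp add: ln_realpow)
    qed
  qed
  define G where "G = (2::real) ^ (K + 1)"
  have G: "G \<ge> 1" unfolding G_def by (rule one_le_power) simp
  \<comment> \<open>the density of the exponents for which \<open>m\<close> terms cost at most \<open>L / 4\<close> in the end\<close>
  define \<epsilon> where "\<epsilon> = ln 2 / (4 * (G + 1) * ln (2 * C))"
  have lnC: "ln (2 * C) > 0" using C by simp
  have \<epsilon>: "\<epsilon> > 0" using G lnC by (simp add: \<epsilon>_def)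
  obtain n1 where n1: "\<And>n. n \<ge> n1 \<Longrightarrow> real (l n) / real n \<ge> 1 / \<epsilon>"
    using dens unfolding filterlim_at_top eventually_sequentially by blast
  define c0 where "c0 = ln 4 + (real n1 + 2) * ln (2 * C)"
  obtain r1 where r1: "\<And>r. r \<ge> r1 \<Longrightarrow> L r \<ge> real (4 * M + 1) * ln r" using Llow by blast
  define c1 where "c1 = max 1 (4 * c0 + 1)"
  define rr where "rr = max (max 2 R0) (max r1 (exp c1))"
  obtain k0 where "rr < (2::real) ^ k0" using real_arch_pow[of 2 rr] by auto
  hence k0: "(2::real) ^ k \<ge> rr" if "k \<ge> k0" for k
    using power_increasing[OF that, of "2::real"] by linarith
  have Lbig: "L r \<ge> 4 * real M * ln r + c1" if "r \<ge> rr" for r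
  proof -
    have "r > 0" "r \<ge> exp c1" using that by (auto simp: rr_def)
    hence "ln r \<ge> c1" by (simp add: ln_ge_iff)
    moreover have "L r \<ge> real (4 * M + 1) * ln r" using r1 that by (auto simp: rr_def)
    ultimately show ?thesis by (simp add: algebra_simps)
  qed
  have Lge1: "L r \<ge> 1" if "r \<ge> rr" for r
  proof -
    have "ln r \<ge> 0" "c1 \<ge> 1" using that by (auto simp: rr_def c1_def)
    thus ?thesis using Lbig[OF that] by (smt (verit) mult_nonneg_nonneg of_nat_0_le_iff)
  qed
  have "\<exists>k\<ge>k0. L (2 ^ Suc k) \<le> 2 ^ (K + 1) * L (2 ^ k)"
  proof (rule frequently_regular_growth)
    show "L (2 ^ k) \<ge> 1" if "k \<ge> k0" for k using Lge1 k0 that by blast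
    show "L (2 ^ k) \<le> 2 ^ (k * K)" if "k \<ge> k0" for k
      using Lup[of "2 ^ k"] k0[OF that] by (simp add: power_mult rr_def)
  qed
  then obtain k where k: "k \<ge> k0" "L (2 ^ Suc k) \<le> G * L (2 ^ k)" unfolding G_def by blast
  define r :: real where "r = 2 ^ k"
  have rrr: "r \<ge> rr" using k0[OF k(1)] by (simp add: r_def)
  have r: "r > 0" "r \<ge> 2" "r \<ge> R0" using rrr by (auto simp: rr_def)
  have reg: "L (2 * r) \<le> G * L r" using k(2) by (simp add: r_def)
  \<comment> \<open>chosen so that \<open>2 Mx (2 r) \<le> 2^N\<close>\<close>
  define N where "N = (G * L r + 1) / ln 2"
  have ex: "\<exists>n. real (l n) > N"
  proof -
    obtain n where "real n > N" using reals_Archimedean2 by blast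
    moreover have "l n \<ge> n" by (rule strict_mono_imp_increasing[OF l])
    ultimately show ?thesis by (intro exI[of _ n]) linarith
  qed
  \<comment> \<open>the number of exponents that do not exceed \<open>N\<close>\<close>
  define m where "m = (LEAST n. real (l n) > N)"
  have m: "real (l m) > N" unfolding m_def using ex by (rule LeastI_ex)
  have m_le: "real m \<le> real n1 + 2 + \<epsilon> * N"
  proof (cases "m \<le> n1 + 1")
    case True
    have "N \<ge> 0" using Lge1[OF rrr] G unfolding N_def by (intro divide_nonneg_pos) (auto intro!: add_nonneg_nonneg)
    hence "\<epsilon> * N \<ge> 0" using \<epsilon> by simp
    moreover have "real m \<le> real n1 + 1" using True by linarith
    ultimately show ?thesis by linarith
  next
    case False
    then obtain j where j: "m = Suc j" "j \<ge> n1" "j > 0" by (cases m) auto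
    have "\<not> real (l j) > N" using j not_less_Least[of j "\<lambda>n. real (l n) > N"] unfolding m_def[symmetric] by simp
    moreover have "real (l j) \<ge> real j / \<epsilon>" using n1[OF j(2)] j(3) \<epsilon> by (simp add: field_simps)
    ultimately have "real j / \<epsilon> \<le> N" by linarith
    hence "real j \<le> \<epsilon> * N" using \<epsilon> by (simp add: field_simps)
    thus ?thesis using j by simp
  qed
  have tail: "norm (B z - (\<Sum>n<m. a n * z ^ l n)) \<le> 1" if z: "norm z = r" for z
  proof -
    have "norm (B z - (\<Sum>n<m. a n * z ^ l n)) \<le> 2 * Mx (2 * r) / 2 ^ l m"
      by (rule gap_tail_bound[OF l B z r(1)]) (use coeff[of "2 * r"] r in auto)
    also have "\<dots> \<le> 1"
    proof -
      have "ln (2 * Mx (2 * r)) = ln 2 + L (2 * r)" using Mxpos[of "2 * r"] r by (simp add: L_def ln_mult)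
      also have "\<dots> \<le> 1 + G * L r" using reg ln_2_less_1 by linarith
      also have "\<dots> = N * ln 2" by (simp add: N_def)
      also have "\<dots> \<le> real (l m) * ln 2" using m by (intro mult_right_mono) auto
      also have "\<dots> = ln (2 ^ l m)" by (simp add: ln_realpow)
      finally have "2 * Mx (2 * r) \<le> 2 ^ l m" using Mxpos[of "2 * r"] r by (subst (asm) ln_le_cancel_iff) auto
      thus ?thesis by simp
    qed
    finally show ?thesis .
  qed
  define c where "c = (\<lambda>n. a n * of_real (r ^ l n))"
  have cis: "(\<Sum>n<m. c n * cis (real (l n) * \<theta>)) = (\<Sum>n<m. a n * (of_real r * cis \<theta>) ^ l n)" for \<theta>
    by (simp add: c_def power_mult_distrib Complex.DeMoivre mult_ac)
  have rM: "r ^ M \<ge> 1" using r by simp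
  have coefm: "norm (c n) \<le> C ^ m * (2 * r ^ M)" if "n < m" for n
    unfolding C_def
  proof (rule Turan_coefficient_bound[OF l that \<alpha>'(1,2)])
    fix \<theta> assume th: "\<psi> \<le> \<theta>" "\<theta> \<le> \<psi> + \<alpha>'"
    define z where "z = of_real r * cis \<theta>"
    have "norm z = r" using r by (simp add: z_def norm_mult)
    have "norm (\<Sum>n<m. a n * z ^ l n) \<le> norm (B z) + norm (B z - (\<Sum>n<m. a n * z ^ l n))"
      by (metis norm_minus_commute norm_triangle_sub)
    also have "\<dots> \<le> r ^ M + 1"
      using sector[OF r(3), of \<theta>] th \<alpha>' tail[OF \<open>norm z = r\<close>] unfolding z_def[symmetric] by (intro add_mono) auto
    also have "\<dots> \<le> 2 * r ^ M" using rM by simp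
    finally show "norm (\<Sum>n<m. c n * cis (real (l n) * \<theta>)) \<le> 2 * r ^ M" unfolding cis z_def .
  qed
  have "Mx r \<le> norm (\<Sum>n<m. a n * (w r) ^ l n) + 1"
    using tail[of "w r"] w(1)[OF r(1)] norm_triangle_sub[of "B (w r)" "\<Sum>n<m. a n * (w r) ^ l n"] by (simp add: Mx_def)
  also have "norm (\<Sum>n<m. a n * (w r) ^ l n) \<le> (\<Sum>n<m. norm (c n))"
    using r w(1)[OF r(1)] by (intro order_trans[OF norm_sum] sum_mono) (simp add: c_def norm_mult norm_power)
  also have "(\<Sum>n<m. norm (c n)) \<le> (\<Sum>n<m. C ^ m * (2 * r ^ M))" using coefm by (intro sum_mono) auto
  also have "\<dots> = real m * (C ^ m * (2 * r ^ M))" by simp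
  also have "\<dots> \<le> 2 ^ m * (C ^ m * (2 * r ^ M))"
    using r C by (intro mult_right_mono) (auto intro: less_imp_le of_nat_less_two_power)
  also have "\<dots> = 2 * ((2 * C) ^ m * r ^ M)" by (simp add: power_mult_distrib)
  also have "2 * ((2 * C) ^ m * r ^ M) + 1 \<le> 4 * ((2 * C) ^ m * r ^ M)"
  proof -
    have "(2 * C) ^ m \<ge> 1" using C by (intro one_le_power) simp
    hence "1 * 1 \<le> (2 * C) ^ m * r ^ M" using rM by (intro mult_mono) auto
    thus ?thesis by linarith
  qed
  finally have "ln (Mx r) \<le> ln (4 * ((2 * C) ^ m * r ^ M))"
    using Mxpos[OF r(1)] by (intro ln_mono) auto
  also have "\<dots> = ln 4 + (real m * ln (2 * C) + real M * ln r)"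
    using C r by (simp add: ln_mult ln_realpow algebra_simps)
  finally have "L r \<le> ln 4 + real m * ln (2 * C) + real M * ln r" by (simp add: L_def)
  also have "real m * ln (2 * C) \<le> (real n1 + 2 + \<epsilon> * N) * ln (2 * C)"
    using m_le lnC by (intro mult_right_mono) auto
  also have "\<epsilon> * N * ln (2 * C) \<le> L r / 4"
  proof -
    have "\<epsilon> * N * ln (2 * C) = (G * L r + 1) / (G + 1) / 4"
      using lnC G by (simp add: \<epsilon>_def N_def)
    also have "\<dots> \<le> ((G + 1) * L r) / (G + 1) / 4"
      using Lge1[OF rrr] G by (intro divide_right_mono) (auto simp: algebra_simps)
    finally show ?thesis using G by simp
  qed
  hence "(real n1 + 2 + \<epsilon> * N) * ln (2 * C) \<le> (real n1 + 2) * ln (2 * C) + L r / 4"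
    by (simp add: algebra_simps)
  finally have "L r \<le> c0 + L r / 4 + real M * ln r" by (simp add: c0_def)
  moreover have "L r \<ge> 4 * real M * ln r + (4 * c0 + 1)" using Lbig[OF rrr] by (simp add: c1_def)
  moreover have "L r \<ge> 1" by (rule Lge1[OF rrr])
  moreover have "real M * ln r \<ge> 0" using r by simp
  ultimately show False by linarith
qed

section \<open>Solutions of the differential equation\<close>

text \<open>
  On the circle the equation expresses \<open>B\<close> by \<open>A\<close> and the quotients \<open>f'/f\<close> and \<open>f''/f\<close>; since \<open>B\<close> is
  entire, the bound passes to the centre.
\<close>

lemma coefficient_bound_on_disc:
  fixes A B f :: "complex \<Rightarrow> complex"
  assumes holB: "B holomorphic_on UNIV"
    and ode: "\<forall>z. deriv (deriv f) z + A z * deriv f z + B z * f z = 0"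
    and t: "0 < t" "t < 1"
    and circ: "\<And>z. norm (z - z0) = t \<Longrightarrow> f z \<noteq> 0 \<and>
         norm (deriv f z / f z) \<le> X \<and> norm (deriv (deriv f) z / f z) \<le> X"
    and A: "\<And>z. norm (z - z0) \<le> 1 \<Longrightarrow> norm (A z) \<le> Y" and Y: "Y \<ge> 1"
  shows "norm (B z0) \<le> 2 * X * Y"
proof (rule maximum_modulus_frontier[where S = "cball z0 t" and f = B])
  fix z assume "z \<in> frontier (cball z0 t)"
  hence z: "norm (z - z0) = t" by (simp add: frontier_cball dist_norm norm_minus_commute)
  have fz: "f z \<noteq> 0" and b1: "norm (deriv f z / f z) \<le> X" and b2: "norm (deriv (deriv f) z / f z) \<le> X"
    using circ[OF z] by auto
  have "B z * f z = - (deriv (deriv f) z + A z * deriv f z)"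
    using minus_unique[OF ode[rule_format, of z]] by (rule sym)
  hence "B z = - (deriv (deriv f) z / f z + A z * (deriv f z / f z))"
    using fz by (simp add: field_simps)
  hence "norm (B z) \<le> norm (deriv (deriv f) z / f z) + norm (A z) * norm (deriv f z / f z)"
    by (metis norm_minus_cancel norm_mult norm_triangle_ineq)
  also have "\<dots> \<le> X + Y * X"
    using b1 b2 A[of z] z t Y by (intro add_mono mult_mono) auto
  also have "\<dots> \<le> 2 * X * Y"
  proof -
    have "X \<ge> 0" using b1 norm_ge_zero order_trans by blast
    hence "X * 1 \<le> X * Y" using Y by (intro mult_left_mono) auto
    thus ?thesis by (simp add: algebra_simps)
  qed
  finally show "norm (B z) \<le> 2 * X * Y" .
next
  show "B holomorphic_on interior (cball z0 t)" by (rule holomorphic_on_subset[OF holB]) simp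
  show "continuous_on (closure (cball z0 t)) B"
    by (rule holomorphic_on_imp_continuous_on[OF holomorphic_on_subset[OF holB]]) simp
qed (use t in auto)

text \<open>
  A disc of radius 1 is seen from the origin under a small angle if its centre is far away; hence it stays
  in the sector if the direction of its centre lies in the middle half.
\<close>

lemma disc_in_sector:
  assumes \<alpha>: "\<alpha> > 0"
  shows "\<exists>R. \<forall>r\<ge>R. \<forall>\<theta> w. \<psi> + \<alpha> / 4 \<le> \<theta> \<and> \<theta> \<le> \<psi> + 3 * \<alpha> / 4 \<and> norm (w - of_real r * cis \<theta>) \<le> 1 \<longrightarrow>
          (\<exists>\<phi>. \<psi> \<le> \<phi> \<and> \<phi> \<le> \<psi> + \<alpha> \<and> w = of_real (norm w) * cis \<phi>)"
proof -
  have "isCont Arg 1" by (rule continuous_at_Arg) (auto simp: complex_nonpos_Reals_iff)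
  then obtain d where d: "d > 0" "\<And>v. dist v 1 < d \<Longrightarrow> dist (Arg v) (Arg 1) < \<alpha> / 4"
    unfolding continuous_at_eps_delta using \<alpha> by (metis zero_less_divide_iff zero_less_numeral)
  show ?thesis
  proof (rule exI[of _ "max 2 (2 / d)"], intro allI impI)
    fix r \<theta> w assume r: "r \<ge> max 2 (2 / d)"
      and h: "\<psi> + \<alpha> / 4 \<le> \<theta> \<and> \<theta> \<le> \<psi> + 3 * \<alpha> / 4 \<and> norm (w - of_real r * cis \<theta>) \<le> 1"
    have r0: "r > 0" using r by simp
    define v where "v = w / (of_real r * cis \<theta>)"
    have w: "w = of_real r * cis \<theta> * v" using r0 by (simp add: v_def)
    have "w - of_real r * cis \<theta> = of_real r * cis \<theta> * (v - 1)" by (simp add: w algebra_simps)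
    hence "norm (w - of_real r * cis \<theta>) = r * norm (v - 1)" using r0 by (simp add: norm_mult)
    hence "r * norm (v - 1) \<le> 1" using h by simp
    hence v1: "norm (v - 1) \<le> 1 / r" using r0 by (simp add: field_simps)
    also have "\<dots> < d"
    proof -
      have "2 \<le> d * r" using r d(1) by (simp add: pos_divide_le_eq mult.commute)
      thus ?thesis using r0 by (simp add: field_simps)
    qed
    finally have "dist v 1 < d" by (simp add: dist_norm)
    hence Arg_v: "\<bar>Arg v\<bar> < \<alpha> / 4" using d(2)[of v] by (simp add: dist_norm)
    have "v \<noteq> 0"
    proof
      assume "v = 0"
      hence "1 \<le> 1 / r" using v1 by simp
      thus False using r by (simp add: field_simps)
    qed
    hence "v = of_real (norm v) * cis (Arg v)" using Arg_eq[of v] by (simp add: cis_conv_exp)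
    hence "w = of_real r * cis \<theta> * (of_real (norm v) * cis (Arg v))" using w by metis
    also have "\<dots> = of_real (r * norm v) * cis (\<theta> + Arg v)" by (simp add: cis_mult[symmetric])
    also have "r * norm v = norm w" using r0 by (simp add: w norm_mult)
    finally have "w = of_real (norm w) * cis (\<theta> + Arg v)" .
    with Arg_v show "\<exists>\<phi>. \<psi> \<le> \<phi> \<and> \<phi> \<le> \<psi> + \<alpha> \<and> w = of_real (norm w) * cis \<phi>"
      using h by (intro exI[of _ "\<theta> + Arg v"] conjI) (auto simp: abs_less_iff)
  qed
qed

theorem theorem2:
  fixes A B f :: "complex \<Rightarrow> complex" and \<rho> \<theta>1 \<theta>2 :: real and p :: nat
  assumes "A holomorphic_on UNIV"
    and "growth_order A = ereal \<rho>" and "\<rho> \<notin> \<int>" and "\<rho> > 1"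
    and "has_genus A p"
    and "\<forall>z. A z = 0 \<longrightarrow> z \<in> angular_sector \<theta>1 \<theta>2"
    and "odd p \<Longrightarrow> \<theta>2 - \<theta>1 < pi / (real p + 1)"
    and "even p \<Longrightarrow> \<theta>2 - \<theta>1 < (2 * real p - 1) * pi / (2 * real p * (real p + 1))"
    and "B holomorphic_on UNIV" and "fabry_gap B"
    and "f holomorphic_on UNIV"
    and "\<forall>z. deriv (deriv f) z + A z * deriv f z + B z * f z = 0"
    and "\<exists>z. f z \<noteq> 0"
  shows "growth_order f = \<infinity>"
proof (rule ccontr)
  assume fin: "growth_order f \<noteq> \<infinity>"
  note holB = \<open>B holomorphic_on UNIV\<close> and holf = \<open>f holomorphic_on UNIV\<close>
  note ode = \<open>\<forall>z. deriv (deriv f) z + A z * deriv f z + B z * f z = 0\<close>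
  obtain K R0 where "R0 > 0" and growth: "\<And>z. norm z \<ge> R0 \<Longrightarrow> norm (f z) \<le> exp (norm z ^ K)"
    using growth_order_finite_imp_norm_bound[OF holf fin] by blast
  obtain c where "f c \<noteq> 0" using assms by blast
  obtain m :: nat and R1 where "R1 > 1" and R1: "\<And>z0. norm z0 \<ge> R1 \<Longrightarrow> \<exists>t. 0 < t \<and> t < 1 \<and>
      (\<forall>z. norm (z - z0) = t \<longrightarrow> f z \<noteq> 0 \<and>
         norm (deriv f z / f z) \<le> norm z0 ^ m \<and> norm (deriv (deriv f) z / f z) \<le> norm z0 ^ m)"
    using log_derivatives_polynomially_bounded[OF holf \<open>f c \<noteq> 0\<close> growth] by blast
  have A_1: "\<exists>R>0. \<forall>z. norm z \<ge> R \<longrightarrow> norm (A z) \<le> exp (norm z ^ (p + 2))"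
    by (rule genus_controls_growth_and_decay(1)[OF assms(1,2,4,5,6)]) (use assms(7,8) in simp_all)
  have A_2: "\<exists>\<psi> \<alpha> R. \<alpha> > 0 \<and> (\<forall>r\<ge>R. \<forall>\<theta>. \<psi> \<le> \<theta> \<and> \<theta> \<le> \<psi> + \<alpha> \<longrightarrow> norm (A (of_real r * cis \<theta>)) \<le> 1)"
    by (rule genus_controls_growth_and_decay(2)[OF assms(1,2,4,5,6)]) (use assms(7,8) in simp_all)
  obtain R2 where "R2 > 0" and R2: "\<And>z. norm z \<ge> R2 \<Longrightarrow> norm (A z) \<le> exp (norm z ^ (p + 2))"
    using A_1 by blast
  obtain \<psi> \<alpha> R3 where \<alpha>: "\<alpha> > 0"
    and R3: "\<And>r \<theta>. r \<ge> R3 \<Longrightarrow> \<psi> \<le> \<theta> \<Longrightarrow> \<theta> \<le> \<psi> + \<alpha> \<Longrightarrow> norm (A (of_real r * cis \<theta>)) \<le> 1"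
    using A_2 by blast
  obtain R4 where R4: "\<forall>r\<ge>R4. \<forall>\<theta> w. \<psi> + \<alpha> / 4 \<le> \<theta> \<and> \<theta> \<le> \<psi> + 3 * \<alpha> / 4 \<and>
      norm (w - of_real r * cis \<theta>) \<le> 1 \<longrightarrow>
      (\<exists>\<phi>. \<psi> \<le> \<phi> \<and> \<phi> \<le> \<psi> + \<alpha> \<and> w = of_real (norm w) * cis \<phi>)"
    using disc_in_sector[OF \<alpha>, of \<psi>] by (elim exE)
  have B_bound: "norm (B z0) \<le> 2 * norm z0 ^ m * Y"
    if far: "norm z0 \<ge> R1" and AY: "\<And>z. norm (z - z0) \<le> 1 \<Longrightarrow> norm (A z) \<le> Y" "Y \<ge> 1" for z0 Y
  proof -
    obtain t where t: "0 < t" "t < 1" "\<And>z. norm (z - z0) = t \<Longrightarrow> f z \<noteq> 0 \<and>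
         norm (deriv f z / f z) \<le> norm z0 ^ m \<and> norm (deriv (deriv f) z / f z) \<le> norm z0 ^ m"
      using R1[OF far] by blast
    show ?thesis by (rule coefficient_bound_on_disc[OF holB ode t AY])
  qed
  \<comment> \<open>far enough for all estimates on discs of radius 1; the last entry absorbs constant factors into powers of \<open>r\<close>\<close>
  define R where "R = Max {R1, R2 + 1, R3 + 1, R4, 2 + real m + 2 ^ (p + 2)}"
  have R: "R1 \<le> R" "R2 + 1 \<le> R" "R3 + 1 \<le> R" "R4 \<le> R" "2 + real m + 2 ^ (p + 2) \<le> R"
    unfolding R_def by (rule Max_ge; simp)+
  have big: "2 * r ^ m \<le> r ^ (m + 1)" if "r \<ge> R" for r
  proof -
    have "r \<ge> 2" using R(5) that by (smt (verit) of_nat_0_le_iff zero_le_power)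
    thus ?thesis by (simp add: mult_right_mono)
  qed
  show False
  proof (rule fabry_gap_not_polynomially_bounded_in_sector[OF holB \<open>fabry_gap B\<close>])
    show "\<alpha> / 2 > 0" using \<alpha> by simp
    show "R > 0" using R(1) \<open>R1 > 1\<close> by simp
    show "norm (B z0) \<le> exp (norm z0 ^ (p + 4))" if z0: "norm z0 \<ge> R" for z0
    proof -
      define r where "r = norm z0"
      have r: "r \<ge> R" "r \<ge> 1" using z0 R(1) \<open>R1 > 1\<close> by (auto simp: r_def)
      have "norm (B z0) \<le> 2 * r ^ m * exp ((2 * r) ^ (p + 2))"
        unfolding r_def
      proof (rule B_bound)
        fix z assume z: "norm (z - z0) \<le> 1"
        have l: "norm z \<ge> r - 1" using z norm_triangle_ineq2[of z0 "z0 - z"] by (simp add: r_def norm_minus_commute)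
        have "norm z \<le> 2 * r" using z norm_triangle_sub[of z z0] r by (simp add: r_def)
        hence "norm z ^ (p + 2) \<le> (2 * r) ^ (p + 2)" by (intro power_mono) auto
        moreover have "norm (A z) \<le> exp (norm z ^ (p + 2))" by (rule R2) (use l R(2) r in linarith)
        ultimately show "norm (A z) \<le> exp ((2 * norm z0) ^ (p + 2))"
          unfolding r_def by (meson exp_le_cancel_iff order_trans)
      qed (use R(1) z0 in auto)
      also have "2 * r ^ m \<le> exp (real (m + 1) * r)"
      proof -
        have "2 * r ^ m \<le> r ^ (m + 1)" by (rule big[OF r(1)])
        also have "\<dots> \<le> exp r ^ (m + 1)"
        proof (rule power_mono)
          show "r \<le> exp r" using exp_ge_add_one_self[of r] by linarith
        qed (use r in simp)
        finally show ?thesis by (simp only: exp_of_nat_mult)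
      qed
      also have "exp (real (m + 1) * r) * exp ((2 * r) ^ (p + 2)) = exp (real (m + 1) * r ^ 1 + 2 ^ (p + 2) * r ^ (p + 2))"
        by (simp only: exp_add power_mult_distrib power_one_right)
      also have "\<dots> \<le> exp (real (m + 1) * r ^ (p + 3) + 2 ^ (p + 2) * r ^ (p + 3))"
        unfolding exp_le_cancel_iff using r by (intro add_mono mult_left_mono power_increasing) auto
      also have "\<dots> = exp ((real (m + 1) + 2 ^ (p + 2)) * r ^ (p + 3))" by (simp only: distrib_right)
      also have "\<dots> \<le> exp (r * r ^ (p + 3))"
        unfolding exp_le_cancel_iff using r R(5) by (intro mult_right_mono) auto
      also have "r * r ^ (p + 3) = r ^ (p + 4)" by (simp add: power_add numeral_eq_Suc)
      finally show ?thesis by (simp add: r_def mult_right_mono)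
    qed
    show "norm (B (of_real r * cis \<theta>)) \<le> r ^ (m + 1)"
      if r: "r \<ge> R" and \<theta>: "\<psi> + \<alpha> / 4 \<le> \<theta>" "\<theta> \<le> \<psi> + \<alpha> / 4 + \<alpha> / 2" for r \<theta>
    proof -
      have r1: "r \<ge> 1" using r R(1) \<open>R1 > 1\<close> by linarith
      define z0 where "z0 = of_real r * cis \<theta>"
      have nz0: "norm z0 = r" using r1 by (simp add: z0_def norm_mult)
      have "norm (B z0) \<le> 2 * norm z0 ^ m * 1"
      proof (rule B_bound)
        fix z assume z: "norm (z - z0) \<le> 1"
        obtain \<phi> where \<phi>: "\<psi> \<le> \<phi>" "\<phi> \<le> \<psi> + \<alpha>" "z = of_real (norm z) * cis \<phi>"
        proof -
          have "\<psi> + \<alpha> / 4 \<le> \<theta> \<and> \<theta> \<le> \<psi> + 3 * \<alpha> / 4 \<and> norm (z - of_real r * cis \<theta>) \<le> 1"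
            using z \<theta> by (simp add: z0_def)
          moreover have "r \<ge> R4" using r R(4) by linarith
          ultimately have "\<exists>\<phi>. \<psi> \<le> \<phi> \<and> \<phi> \<le> \<psi> + \<alpha> \<and> z = of_real (norm z) * cis \<phi>"
            using R4 by blast
          thus ?thesis using that by blast
        qed
        have "norm z \<ge> r - 1" using z norm_triangle_ineq2[of z0 "z0 - z"] nz0 by (simp add: norm_minus_commute)
        hence "norm z \<ge> R3" using R(3) r by linarith
        from R3[OF this \<phi>(1,2)] show "norm (A z) \<le> 1" using \<phi>(3) by simp
      qed (use R(1) r nz0 in auto)
      also have "\<dots> \<le> r ^ (m + 1)" using big[OF r] by (simp add: nz0)
      finally show ?thesis by (simp add: z0_def)
    qed
  qed
qed

end
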